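(* (1) Every $\pi$-commensurable triangle has a $\pi$-commensurable subdivision, namely the one determined by its angle bisectors (that is, by taking the interior point $P$ to be the incenter). (2) There are infinitely many $\pi$-commensurable triangles, up to similarity, which have no $\pi$-commensurable subdivision other than the one determined by the angle bisectors. (3) Every non-isosceles $\pi$-commensurable triangle has only finitely many $\pi$-commensurable subdivisions.
   Context: All triangles are non-degenerate triangles in the Euclidean plane. A triangle is called $\pi$-commensurable if each of its angles (in radians) is a rational multiple of $\pi$. Let $ABC$ be a triangle and $P$ a point in its interior. The lines $AP$, $BP$, $CP$ (extended to the opposite sides) divide $ABC$ into six subtriangles, each having $P$ as a vertex; this is the subdivision determined by $P$. For a $\pi$-commensurable triangle $ABC$, the subdivision determined by $P$ is called $\pi$-commensurable if all six subtriangles are $\pi$-commensurable; equivalently, if the six angles $\angle PAB, \angle PAC, \angle PBC, \angle PBA, \angle PCA, \angle PCB$ are all rational multiples of $\pi$. Two subdivisions of a given triangle are distinct if they are determined by distinct interior points $P$. *)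

theory Defs
  imports "HOL-Analysis.Analysis"
begin

type_synonym point = "real^2"

(* The unoriented angle XYZ at the vertex Y, in [0, pi]. It is used only with X, Z different from Y. *)
definition angle :: "point \<Rightarrow> point \<Rightarrow> point \<Rightarrow> real" where
  "angle X Y Z = arccos (inner (X - Y) (Z - Y) / (norm (X - Y) * norm (Z - Y)))"

definition rational_multiple_of_pi :: "real \<Rightarrow> bool" where
  "rational_multiple_of_pi t \<longleftrightarrow> (\<exists>q\<in>\<rat>. t = q * pi)"

definition triangle :: "point \<Rightarrow> point \<Rightarrow> point \<Rightarrow> bool" where
  "triangle A B C \<longleftrightarrow> \<not> collinear {A, B, C}"

definition isosceles :: "point \<Rightarrow> point \<Rightarrow> point \<Rightarrow> bool" where
  "isosceles A B C \<longleftrightarrow> dist A B = dist A C \<or> dist B A = dist B C \<or> dist C A = dist C B"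

definition pi_commensurable :: "point \<Rightarrow> point \<Rightarrow> point \<Rightarrow> bool" where
  "pi_commensurable A B C \<longleftrightarrow> triangle A B C
     \<and> rational_multiple_of_pi (angle B A C)
     \<and> rational_multiple_of_pi (angle A B C)
     \<and> rational_multiple_of_pi (angle A C B)"

definition inside_triangle :: "point \<Rightarrow> point \<Rightarrow> point \<Rightarrow> point \<Rightarrow> bool" where
  "inside_triangle A B C P \<longleftrightarrow> P \<in> interior (convex hull {A, B, C})"

(* D, E, F are the points where the lines AP, BP, CP meet the opposite sides BC, CA, AB.
   For P inside a triangle ABC each of them exists and is unique, so the existential
   quantifier only names them. *)
definition pi_commensurable_subdivision :: "point \<Rightarrow> point \<Rightarrow> point \<Rightarrow> point \<Rightarrow> bool" where
  "pi_commensurable_subdivision A B C P \<longleftrightarrow> inside_triangle A B C P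
     \<and> (\<exists>D E F. D \<in> affine hull {A, P} \<inter> closed_segment B C
            \<and> E \<in> affine hull {B, P} \<inter> closed_segment C A
            \<and> F \<in> affine hull {C, P} \<inter> closed_segment A B
            \<and> pi_commensurable P A F \<and> pi_commensurable P F B
            \<and> pi_commensurable P B D \<and> pi_commensurable P D C
            \<and> pi_commensurable P C E \<and> pi_commensurable P E A)"

(* P is the common point of the three interior angle bisectors. *)
definition is_incenter :: "point \<Rightarrow> point \<Rightarrow> point \<Rightarrow> point \<Rightarrow> bool" where
  "is_incenter A B C P \<longleftrightarrow> inside_triangle A B C P
     \<and> angle P A B = angle P A C
     \<and> angle P B C = angle P B A
     \<and> angle P C A = angle P C B"

(* Vertex sets are compared, so the order in which the vertices are listed is irrelevant;
   the similarity f of the plane may reverse orientation. *)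
definition similar_triangles :: "((point \<times> point \<times> point) \<times> (point \<times> point \<times> point)) set" where
  "similar_triangles = {((A, B, C), (A', B', C')) | A B C A' B' C'.
     \<exists>f :: point \<Rightarrow> point. \<exists>r > 0. (\<forall>X Y. dist (f X) (f Y) = r * dist X Y)
        \<and> f ` {A, B, C} = {A', B', C'}}"

end

theory Submission imports Defs "HOL-Number_Theory.Cong"
begin

text \<open>Let \<open>\<alpha>, \<beta>, \<gamma>\<close> be the angles of the triangle. An interior point \<open>P\<close> splits them into
\<open>\<alpha>/2 \<plusminus> u\<close>, \<open>\<beta>/2 \<plusminus> v\<close>, \<open>\<gamma>/2 \<plusminus> w\<close>, and the trigonometric form of Ceva's theorem
relates the six parts. Because \<open>\<alpha> + \<beta> + \<gamma> = pi\<close>, its product form collapses to the sine equation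

  \<open>sin \<alpha> sin p + sin \<beta> sin q + sin \<gamma> sin r = 0\<close>  with  \<open>p = -u+v+w, q = u-v+w, r = u+v-w\<close>,

and the condition that \<open>P\<close> lies inside becomes \<open>|q+r| < \<alpha>\<close>, \<open>|p+r| < \<beta>\<close>, \<open>|p+q| < \<gamma>\<close>.
The subdivision of a commensurable triangle is commensurable iff \<open>u, v, w\<close> are rational multiples of pi, the
incenter is the solution \<open>p = q = r = 0\<close>, and distinct points give distinct \<open>(p, q, r)\<close>. This settles the
first claim and turns the other two into questions about a vanishing sum of the six roots of unity
\<open>cis (\<plusminus>p), cis (\<plusminus>q), cis (\<plusminus>r)\<close> with cyclotomic coefficients.

The arithmetic input is of Mann type (\<open>vanishing_sum_splits_into_classes\<close>): if a sum of \<open>n\<close> terms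
\<open>c_i \<zeta>_i\<close> vanishes, where the \<open>\<zeta>_i\<close> are roots of unity, the \<open>c_i\<close> are sums of N-th roots of
unity and every prime up to \<open>n\<close> divides \<open>N\<close>, then the terms with a common value of \<open>\<zeta>_i^N\<close> already
sum to 0. It rests on Galois conjugation, proved directly by Landau's argument
(\<open>galois_conjugation_of_root_sums\<close>).

For the sine equation take \<open>N\<close> divisible by 30 such that \<open>\<alpha>, \<beta>, \<gamma>\<close> are multiples of \<open>2 pi / N\<close>. If
\<open>cis p\<close> and \<open>cis (-p)\<close> lay in different classes, the class of \<open>cis p\<close> would be a vanishing sum
of at most three terms with distinct absolute values among \<open>sin \<alpha>, sin \<beta>, sin \<gamma>\<close>. One term is
impossible, two terms would force two equal angles, and three terms close up to a triangle
with the angles \<open>\<alpha>, \<beta>, \<gamma>\<close> again, a configuration which the inequalities exclude. So in a scalene triangle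
\<open>p, q, r\<close> are multiples of \<open>pi / N\<close> (\<open>rational_solutions_have_bounded_denominator\<close>), which leaves
finitely many points.

The same class argument shows that the odd multiples of \<open>pi / N\<close> among \<open>p, q, r\<close> satisfy the equation on
their own. For the triangles with angles \<open>2 pi / N\<close>, \<open>4 pi / N\<close>, \<open>pi - 6 pi / N\<close> and 30 dividing \<open>N\<close>,
this parity condition and the inequalities leave a handful of cases, each excluded by elementary trigonometry
(\<open>special_triangle_only_trivial_solution\<close>). These triangles are pairwise dissimilar, which gives the second claim.\<close>

section \<open>Sums of roots of unity and their Galois conjugates\<close>

text \<open>For positive even \<open>M\<close> this is the ring of integers of the M-th cyclotomic field. Nonnegative combinations are
enough for the congruences below and make every element the sum of a plain list of roots.\<close>

inductive_set root_sums :: "nat \<Rightarrow> complex set" for M where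
  zero: "0 \<in> root_sums M"
| add_root: "z ^ M = 1 \<Longrightarrow> x \<in> root_sums M \<Longrightarrow> z + x \<in> root_sums M"

lemma root_sums_add: "x \<in> root_sums M \<Longrightarrow> y \<in> root_sums M \<Longrightarrow> x + y \<in> root_sums M"
  by (induction rule: root_sums.induct) (auto simp: add.assoc intro: root_sums.add_root)

lemma root_sums_root: "z ^ M = 1 \<Longrightarrow> z \<in> root_sums M"
  using root_sums.add_root[OF _ root_sums.zero, of z M] by simp

lemma root_sums_root_mult: "y \<in> root_sums M \<Longrightarrow> z ^ M = 1 \<Longrightarrow> z * y \<in> root_sums M"
  by (induction rule: root_sums.induct)
     (auto simp: distrib_left power_mult_distrib intro: root_sums.intros)

lemma root_sums_mult: "x \<in> root_sums M \<Longrightarrow> y \<in> root_sums M \<Longrightarrow> x * y \<in> root_sums M"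
  by (induction rule: root_sums.induct)
     (auto simp: distrib_right intro: root_sums.zero root_sums_add root_sums_root_mult)

lemma root_sums_power: "x \<in> root_sums M \<Longrightarrow> x ^ k \<in> root_sums M"
  by (induction k) (auto intro: root_sums_mult root_sums_root)

lemma root_sums_sum: "(\<And>i. i \<in> A \<Longrightarrow> f i \<in> root_sums M) \<Longrightarrow> sum f A \<in> root_sums M"
  by (induction A rule: infinite_finite_induct) (auto intro: root_sums.zero root_sums_add)

lemma root_sums_of_nat: "of_nat n \<in> root_sums M"
  by (induction n) (auto intro: root_sums.intros)

lemma root_sums_frobenius_add:
  assumes "prime p" "a \<in> root_sums M" "b \<in> root_sums M"
  shows "\<exists>r\<in>root_sums M. (a + b) ^ p = a ^ p + b ^ p + of_nat p * r"
proof -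
  define r where "r = (\<Sum>k\<in>{1..<p}. of_nat ((p choose k) div p) * a ^ k * b ^ (p - k))"
  have "p > 0" using assms(1) prime_gt_0_nat by blast
  have eq: "of_nat (p choose k) * a ^ k * b ^ (p - k)
        = of_nat p * (of_nat ((p choose k) div p) * a ^ k * b ^ (p - k))" if "k \<in> {1..<p}" for k
  proof -
    have "p dvd (p choose k)" using that assms(1) by (intro dvd_choose_prime) auto
    then have "p choose k = p * ((p choose k) div p)" by (metis dvd_mult_div_cancel)
    then have "of_nat (p choose k) = (of_nat p * of_nat ((p choose k) div p) :: complex)"
      by (metis of_nat_mult)
    then show ?thesis by simp
  qed
  have "{..p} = insert 0 (insert p {1..<p})" using \<open>p > 0\<close> by auto
  then have "(a + b) ^ p = b ^ p + (a ^ p + (\<Sum>k\<in>{1..<p}. of_nat (p choose k) * a ^ k * b ^ (p - k)))"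
    using \<open>p > 0\<close> by (simp add: binomial_ring)
  also have "(\<Sum>k\<in>{1..<p}. of_nat (p choose k) * a ^ k * b ^ (p - k)) = of_nat p * r"
    unfolding r_def sum_distrib_left by (rule sum.cong[OF refl eq])
  finally have "(a + b) ^ p = a ^ p + b ^ p + of_nat p * r" by simp
  moreover have "r \<in> root_sums M"
    unfolding r_def using assms(2,3)
    by (intro root_sums_sum root_sums_mult root_sums_power root_sums_of_nat)
  ultimately show ?thesis by blast
qed

text \<open>The Frobenius congruence \<open>(x + y)^p = x^p + y^p\<close> modulo \<open>p\<close>, iterated along a list.\<close>

lemma root_sums_frobenius:
  assumes "prime p" "\<forall>z\<in>set L. z ^ M = 1"
  shows "\<exists>r\<in>root_sums M. sum_list L ^ p = (\<Sum>z\<leftarrow>L. z ^ p) + of_nat p * r"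
  using assms(2)
proof (induction L)
  case Nil
  then show ?case using assms(1) prime_gt_0_nat
    by (intro bexI[of _ 0]) (auto intro: root_sums.zero)
next
  case (Cons z L)
  then obtain r where r: "r \<in> root_sums M" "sum_list L ^ p = (\<Sum>z\<leftarrow>L. z ^ p) + of_nat p * r" by auto
  have "sum_list L \<in> root_sums M" using Cons.prems by (induction L) (auto intro: root_sums.intros)
  then obtain r' where r': "r' \<in> root_sums M" "(z + sum_list L) ^ p = z ^ p + sum_list L ^ p + of_nat p * r'"
    using root_sums_frobenius_add[OF assms(1), of z M "sum_list L"] Cons.prems root_sums_root by auto
  show ?case
    by (rule bexI[of _ "r + r'"]) (use r r' in \<open>auto simp: algebra_simps intro: root_sums_add\<close>)
qed

text \<open>A coordinate with respect to a basis of the complex numbers over the rationals that contains \<open>z\<close>. It takes the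
place of norms and integral bases in the divisibility argument below.\<close>

lemma rational_functional:
  assumes "z \<noteq> (0::complex)"
  obtains \<phi> :: "complex \<Rightarrow> rat" where "\<And>x y. \<phi> (x + y) = \<phi> x + \<phi> y"
    "\<And>q x. \<phi> (of_rat q * x) = q * \<phi> x" "\<phi> z = 1"
proof -
  interpret vector_space "\<lambda>(q::rat) x::complex. of_rat q * x"
    by unfold_locales (auto simp: algebra_simps of_rat_add of_rat_mult)
  have ind: "independent {z}" using assms by (simp add: dependent_single)
  define B where "B = extend_basis {z}"
  have B: "independent B" "span B = UNIV" "z \<in> B"
    unfolding B_def using independent_extend_basis[OF ind] span_extend_basis[OF ind] extend_basis_superset[OF ind] by auto
  show thesis
    by (rule that[of "\<lambda>x. representation B x z"])
       (use B in \<open>auto simp: representation_add representation_scale representation_basis\<close>)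
qed

text \<open>A nonzero \<open>z\<close> is divisible by only finitely many primes. Choose a rational functional with value 1 at
\<open>z\<close>. Its values on the finitely many M-th roots of unity have a common denominator \<open>D\<close>, hence so do its
values on all of \<open>root_sums M\<close>, and \<open>z = - p r\<close> forces \<open>p\<close> to divide \<open>D\<close>.\<close>

lemma root_sum_few_prime_divisors:
  assumes "M > 0" "z \<noteq> 0"
  shows "\<exists>B::nat. \<forall>p r. p > B \<longrightarrow> r \<in> root_sums M \<longrightarrow> z + of_nat p * r \<noteq> 0"
proof -
  obtain \<phi> :: "complex \<Rightarrow> rat" where \<phi>: "\<And>x y. \<phi> (x + y) = \<phi> x + \<phi> y"
    "\<And>q x. \<phi> (of_rat q * x) = q * \<phi> x" "\<phi> z = 1"
    using rational_functional[OF assms(2)] by blast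
  have phi0: "\<phi> 0 = 0" using \<phi>(1)[of 0 0] by simp
  have fin: "finite {w::complex. w ^ M = 1}" using assms(1) by (intro finite_roots_unity) auto
  define D where "D = (\<Prod>w\<in>{w. w ^ M = 1}. snd (quotient_of (\<phi> w)))"
  have "D > 0" unfolding D_def by (intro prod_pos) (auto simp: quotient_of_denom_pos')
  have D: "of_int D * \<phi> w \<in> \<int>" if "w ^ M = 1" for w
  proof -
    define d where "d = snd (quotient_of (\<phi> w))"
    have "d dvd D" unfolding D_def d_def using fin that by (intro dvd_prodI) auto
    then obtain e where e: "D = d * e" by auto
    define m where "m = fst (quotient_of (\<phi> w))"
    have "\<phi> w = of_int m / of_int d" unfolding d_def m_def
      by (metis prod.collapse quotient_of_div)
    moreover have "d > 0" unfolding d_def by (simp add: quotient_of_denom_pos')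
    ultimately have "of_int d * \<phi> w = of_int m" by simp
    then have "of_int D * \<phi> w = of_int (e * m)"
      by (simp add: e mult.assoc mult.left_commute)
    then show ?thesis by (metis Ints_of_int)
  qed
  have Dr: "of_int D * \<phi> r \<in> \<int>" if "r \<in> root_sums M" for r
    using that by (induction rule: root_sums.induct) (auto simp: phi0 \<phi>(1) distrib_left D)
  show ?thesis
  proof (intro exI[of _ "nat D"] allI impI notI)
    fix p :: nat and r assume p: "p > nat D" and r: "r \<in> root_sums M" and 0: "z + of_nat p * r = 0"
    have "\<phi> (of_nat p * r) = of_nat p * \<phi> r" using \<phi>(2)[of "of_nat p" r] by simp
    then have "1 + of_nat p * \<phi> r = 0" using \<phi>(1)[of z "of_nat p * r"] by (simp add: 0 phi0 \<phi>(3))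
    then have "of_int D * (1 + of_nat p * \<phi> r) = 0" by simp
    moreover obtain e where "of_int D * \<phi> r = of_int e" using Dr[OF r] Ints_cases by blast
    ultimately have "of_int D + of_nat p * of_int e = (0 :: rat)"
      by (metis distrib_left mult.left_commute mult.right_neutral)
    then have "of_int (D + int p * e) = (0 :: rat)" by simp
    then have "D + int p * e = 0" by (simp only: of_int_eq_0_iff)
    then have "D = int p * (- e)" by simp
    then have "int p dvd D" by (rule dvdI)
    then show False using p \<open>D > 0\<close> zdvd_imp_le by fastforce
  qed
qed

lemma common_prime_factor:
  fixes a b :: nat assumes "\<not> coprime a b"
  obtains p where "prime p" "p dvd a" "p dvd b"
proof -
  have "gcd a b \<noteq> 1" using assms by (simp add: coprime_iff_gcd_eq_1)
  then obtain p where "prime p" "p dvd gcd a b" using prime_factor_nat by blast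
  then show thesis using that by simp
qed

text \<open>\<open>M\<close> splits into a factor supported on the primes of \<open>N\<close> and a factor coprime to \<open>N\<close>.\<close>

lemma coprime_part:
  fixes M N :: nat assumes "M > 0"
  shows "\<exists>A Q. M = A * Q \<and> coprime Q N \<and> (\<forall>p. prime p \<longrightarrow> p dvd A \<longrightarrow> p dvd N)"
  using assms
proof (induction M rule: less_induct)
  case (less M)
  show ?case
  proof (cases "coprime M N")
    case True
    then show ?thesis by (intro exI[of _ 1] exI[of _ M]) auto
  next
    case False
    then obtain p where p: "prime p" "p dvd M" "p dvd N"
      by (rule common_prime_factor)
    then obtain M' where M': "M = p * M'" by auto
    have "M' > 0" using less.prems M' by (cases M') auto
    then have "M' < M" using prime_gt_1_nat[OF p(1)] M' by simp
    then obtain A Q where AQ: "M' = A * Q" "coprime Q N" "\<forall>p. prime p \<longrightarrow> p dvd A \<longrightarrow> p dvd N"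
      using less.IH \<open>M' > 0\<close> by blast
    show ?thesis
    proof (intro exI conjI allI impI)
      show "M = p * A * Q" using M' AQ(1) by simp
      show "coprime Q N" by fact
      fix q assume "prime q" "q dvd p * A"
      then show "q dvd N" using AQ(3) p(1,3) by (metis prime_dvd_mult_iff primes_dvd_imp_eq)
    qed
  qed
qed

lemma power_cong_root:
  assumes "(z::complex) ^ M = 1" "[j = k] (mod M)"
  shows "z ^ j = z ^ k"
proof -
  have "z ^ m = z ^ (m mod M)" for m
  proof -
    have "z ^ m = z ^ (M * (m div M) + m mod M)" by simp
    then show ?thesis unfolding power_add power_mult assms(1) by simp
  qed
  then show ?thesis using assms(2) unfolding cong_def by metis
qed

text \<open>Induction over the prime factors of \<open>k\<close>: if the m-th powers sum to 0, then Frobenius makes the sum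
of the (pm)-th powers divisible by \<open>p\<close>, and no prime beyond \<open>B\<close> divides a nonzero sum of this kind.\<close>

lemma sum_root_powers_eq_0_if_large_prime_factors:
  assumes L: "\<forall>z\<in>set L. z ^ M = 1"
    and B: "\<And>j p r. p > B \<Longrightarrow> r \<in> root_sums M \<Longrightarrow> (\<Sum>z\<leftarrow>L. z ^ j) + of_nat p * r = 0
              \<Longrightarrow> (\<Sum>z\<leftarrow>L. z ^ j) = 0"
    and "sum_list L = 0" "k > 0" "\<And>p. prime p \<Longrightarrow> p dvd k \<Longrightarrow> p > (B::nat)"
  shows "(\<Sum>z\<leftarrow>L. z ^ k) = 0"
  using assms(4,5)
proof (induction k rule: less_induct)
  case (less k)
  show ?case
  proof (cases "k = 1")
    case True
    then show ?thesis using assms(3) by simp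
  next
    case False
    then obtain p where p: "prime p" "p dvd k" using prime_factor_nat by blast
    then obtain m where m: "k = p * m" by auto
    have "m > 0" "m < k" using m less.prems(1) prime_gt_1_nat[OF p(1)] by auto
    have 0: "(\<Sum>z\<leftarrow>L. z ^ m) = 0"
      by (rule less.IH) (use \<open>m > 0\<close> \<open>m < k\<close> less.prems(2) m in auto)
    have "\<forall>z\<in>set (map (\<lambda>z. z ^ m) L). z ^ M = 1"
      using L by (auto simp: power_commutes simp flip: power_mult) (metis mult.commute power_mult power_one)
    from root_sums_frobenius[OF p(1) this] obtain r where r: "r \<in> root_sums M"
      "(\<Sum>z\<leftarrow>L. z ^ m) ^ p = (\<Sum>z\<leftarrow>map (\<lambda>z. z ^ m) L. z ^ p) + of_nat p * r" by blast
    have "(\<Sum>z\<leftarrow>L. z ^ k) + of_nat p * r = 0"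
      using r(2) 0 prime_gt_0_nat[OF p(1)]
      by (simp add: m o_def mult.commute zero_power flip: power_mult)
    then show ?thesis using B[OF less.prems(2)[OF p] r(1)] by blast
  qed
qed

text \<open>Landau's argument. The sums of j-th powers depend only on \<open>j\<close> modulo \<open>M\<close>, so one bound \<open>B\<close> on the primes
dividing them serves for all \<open>j\<close>. By the Chinese remainder theorem \<open>k\<close> may be replaced by a congruent exponent all
of whose prime factors exceed \<open>B\<close>.\<close>

theorem galois_conjugation_of_root_sums:
  assumes L: "\<forall>z\<in>set L. (z::complex) ^ M = 1" and "M > 0" "sum_list L = 0" "coprime k M"
  shows "(\<Sum>z\<leftarrow>L. z ^ k) = 0"
proof -
  define v where "v j = (\<Sum>z\<leftarrow>L. z ^ j)" for j
  have v_mod: "v j = v j'" if "[j = j'] (mod M)" for j j'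
    unfolding v_def using L that by (intro arg_cong[of _ _ sum_list] map_cong) (auto intro: power_cong_root)
  have "\<exists>B::nat. v j \<noteq> 0 \<longrightarrow> (\<forall>p r. p > B \<longrightarrow> r \<in> root_sums M \<longrightarrow> v j + of_nat p * r \<noteq> 0)" for j
    using root_sum_few_prime_divisors[OF assms(2)] by blast
  then obtain b :: "nat \<Rightarrow> nat" where b:
    "\<And>j p r. v j \<noteq> 0 \<Longrightarrow> p > b j \<Longrightarrow> r \<in> root_sums M \<Longrightarrow> v j + of_nat p * r \<noteq> 0" by metis
  define B where "B = Max (b ` {..<M})"
  have B: "v j = 0" if "p > B" "r \<in> root_sums M" "v j + of_nat p * r = 0" for j p r
  proof -
    have "b (j mod M) \<le> B" unfolding B_def using assms(2) by (intro Max_ge) auto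
    moreover have "v (j mod M) = v j" by (intro v_mod) (auto simp: cong_def)
    ultimately show ?thesis using b[of "j mod M" p r] that by auto
  qed
  \<comment> \<open>Primes up to \<open>B\<close> dividing \<open>M\<close> are kept out by coprimality, the others by congruence to 1 modulo \<open>Q\<close>.\<close>
  obtain A Q where AQ: "fact B = A * Q" "coprime Q M" "\<forall>p. prime p \<longrightarrow> p dvd A \<longrightarrow> p dvd M"
    using coprime_part[of "fact B" M] by auto
  obtain k' where k': "[k' = k] (mod M)" "[k' = 1] (mod Q)"
    using binary_chinese_remainder_nat[of M Q k 1] AQ(2) by (auto simp: coprime_commute)
  \<comment> \<open>The remainder may be 0; adding the modulus makes the exponent positive.\<close>
  define k'' where "k'' = k' + M * Q"
  have k'': "[k'' = k] (mod M)" "[k'' = 1] (mod Q)" "k'' > 0"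
  proof -
    have "Q \<noteq> 0" using AQ(1) by (metis fact_nonzero mult_0_right)
    then show "k'' > 0" using assms(2) by (auto simp: k''_def)
    show "[k'' = k] (mod M)" "[k'' = 1] (mod Q)" using k' by (auto simp: k''_def cong_def)
  qed
  have "v k'' = 0" unfolding v_def
  proof (rule sum_root_powers_eq_0_if_large_prime_factors[OF L, of B])
    fix p assume p: "prime p" "p dvd k''"
    show "p > B"
    proof (rule ccontr)
      assume "\<not> p > B"
      then have "p dvd (fact B :: nat)" using p(1) prime_dvd_fact_iff by auto
      then have "p dvd A \<or> p dvd Q" using p(1) AQ(1) by (simp add: prime_dvd_mult_iff)
      moreover have "coprime k'' M" "coprime k'' Q"
        using k'' assms(4) by (metis cong_sym cong_imp_coprime, metis cong_sym cong_imp_coprime coprime_1_left)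
      ultimately have "p dvd 1" using AQ(3) p by (metis coprime_common_divisor_nat not_prime_1 one_dvd)
      then show False using p(1) not_prime_unit by blast
    qed
  qed (use B assms(3) k''(3) in \<open>auto simp: v_def\<close>)
  then show ?thesis using v_mod[OF k''(1)] by (simp add: v_def)
qed

section \<open>Vanishing sums of few roots of unity\<close>

text \<open>Vandermonde by interpolation: combine the vanishing moments to the polynomial that vanishes at
all values of \<open>\<omega>\<close> except \<open>\<mu>\<close>; its degree is less than \<open>card I\<close>.\<close>

lemma moments_vanish_imp_classes_vanish:
  fixes c \<omega> :: "'i \<Rightarrow> complex"
  assumes "finite I" "\<And>j. j < card I \<Longrightarrow> (\<Sum>i\<in>I. c i * \<omega> i ^ j) = 0"
  shows "(\<Sum>i | i \<in> I \<and> \<omega> i = \<mu>. c i) = 0"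
proof (cases "\<mu> \<in> \<omega> ` I")
  case False
  then have "{i. i \<in> I \<and> \<omega> i = \<mu>} = {}" by auto
  then show ?thesis by (simp only: sum.empty)
next
  case True
  define f where "f = (\<Prod>\<nu>\<in>\<omega> ` I - {\<mu>}. [:- \<nu>, 1:])"
  have "degree f = card (\<omega> ` I - {\<mu>})" unfolding f_def
    by (subst degree_prod_eq_sum_degree) auto
  also have "\<dots> < card (\<omega> ` I)" using True assms(1) by (intro psubset_card_mono) auto
  also have "\<dots> \<le> card I" using assms(1) by (rule card_image_le)
  finally have deg: "degree f < card I" .
  have poly_f: "poly f x = (\<Prod>\<nu>\<in>\<omega> ` I - {\<mu>}. x - \<nu>)" for x unfolding f_def by (simp add: poly_prod)
  have "0 = (\<Sum>j\<le>degree f. coeff f j * (\<Sum>i\<in>I. c i * \<omega> i ^ j))"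
    using deg assms(2) by (intro sum.neutral[symmetric]) auto
  also have "\<dots> = (\<Sum>i\<in>I. c i * poly f (\<omega> i))"
    unfolding poly_altdef sum_distrib_left by (subst sum.swap) (simp add: mult.left_commute)
  also have "\<dots> = (\<Sum>i | i \<in> I \<and> \<omega> i = \<mu>. c i * poly f (\<omega> i))"
    using assms(1) by (intro sum.mono_neutral_right) (auto simp: poly_f intro!: prod_zero)
  also have "\<dots> = (\<Sum>i | i \<in> I \<and> \<omega> i = \<mu>. c i) * poly f \<mu>" by (simp add: sum_distrib_right)
  finally have "(\<Sum>i | i \<in> I \<and> \<omega> i = \<mu>. c i) * poly f \<mu> = 0" by simp
  moreover have "poly f \<mu> \<noteq> 0" using assms(1) by (auto simp: poly_f)
  ultimately show ?thesis by simp
qed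

lemma root_sums_conv_list: "x \<in> root_sums N \<Longrightarrow> \<exists>L. (\<forall>z\<in>set L. z ^ N = 1) \<and> x = sum_list L"
proof (induction rule: root_sums.induct)
  case zero
  show ?case by (rule exI[of _ "[]"]) simp
next
  case (add_root z x)
  then obtain L where "\<forall>z\<in>set L. z ^ N = 1" "x = sum_list L" by blast
  with add_root show ?case by (intro exI[of _ "z # L"]) simp
qed

text \<open>The exponents by which a relation will be conjugated. At a prime that divides \<open>N\<close> every term is
congruent to 1. At any other prime divisor of \<open>M\<close> the step \<open>N s\<close> is chosen congruent to 1, so the terms are
\<open>1, 2, ..., n\<close> there, and such a prime exceeds \<open>n\<close>.\<close>

lemma coprime_progression:
  fixes M N n :: nat
  assumes "M > 0" "N > 0" "\<And>p. prime p \<Longrightarrow> p \<le> n \<Longrightarrow> p dvd N"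
  obtains s where "coprime s M" "\<And>j. j < n \<Longrightarrow> coprime (1 + j * (N * s)) M"
proof -
  obtain A Q where AQ: "M = A * Q" "coprime Q N" "\<forall>p. prime p \<longrightarrow> p dvd A \<longrightarrow> p dvd N"
    using coprime_part[OF assms(1)] by blast
  obtain t where t: "[N * t = 1] (mod Q)"
    using cong_solve_coprime_nat[of N Q] AQ(2) by (auto simp: coprime_commute)
  obtain s where s: "[s = t] (mod Q)" "[s = 1] (mod N)"
    using binary_chinese_remainder_nat[OF AQ(2), of t 1] by auto
  have Ns: "[N * s = 1] (mod Q)" using s(1) t by (meson cong_scalar_left cong_trans)
  have split: "p dvd N \<or> p dvd Q \<and> \<not> p dvd N" if "prime p" "p dvd M" for p
    using that AQ by (auto simp: prime_dvd_mult_iff)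
  show thesis
  proof (rule that[of s])
    show "coprime s M"
    proof (rule ccontr)
      assume "\<not> coprime s M"
      then obtain p where p: "prime p" "p dvd s" "p dvd M"
        by (rule common_prime_factor)
      have "[N * s = 1] (mod p)" if "p dvd Q" using Ns that by (rule cong_dvd_modulus_nat)
      moreover have "[s = 1] (mod p)" if "p dvd N" using s(2) that by (rule cong_dvd_modulus_nat)
      ultimately have "p dvd 1" using split[OF p(1,3)] p(2) by (metis cong_dvd_iff dvd_mult)
      then show False using p(1) not_prime_unit by blast
    qed
  next
    fix j assume "j < n"
    show "coprime (1 + j * (N * s)) M"
    proof (rule ccontr)
      assume "\<not> ?thesis"
      then obtain p where p: "prime p" "p dvd 1 + j * (N * s)" "p dvd M"
        by (rule common_prime_factor)
      consider "p dvd N" | "p dvd Q" "\<not> p dvd N" using split[OF p(1,3)] by blast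
      then show False
      proof cases
        case 1
        then have "p dvd 1" using p(2) by (metis dvd_add_left_iff dvd_mult dvd_mult2)
        then show False using p(1) not_prime_unit by blast
      next
        case 2
        have "[N * s = 1] (mod p)" using Ns 2(1) by (rule cong_dvd_modulus_nat)
        then have "[1 + j * (N * s) = 1 + j * 1] (mod p)"
          by (intro cong_add cong_scalar_left) auto
        then have "p dvd 1 + j" using p(2) by (metis cong_dvd_iff mult.right_neutral)
        then have "p \<le> n" using \<open>j < n\<close> by (auto dest: dvd_imp_le)
        then show False using assms(3) p(1) 2(2) by blast
      qed
    qed
  qed
qed

text \<open>Conjugation by an exponent \<open>1 + j N s\<close> fixes the coefficients and multiplies each term by
the j-th power of \<open>\<zeta>_i^(N s)\<close>. With as many exponents as terms, the Vandermonde lemma separates the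
terms by the value of \<open>\<zeta>_i^(N s)\<close>. This is the same as separating them by \<open>\<zeta>_i^N\<close>,
because \<open>s\<close> is coprime to the orders of the \<open>\<zeta>_i\<close>.\<close>

theorem vanishing_sum_splits_into_classes:
  fixes c \<zeta> :: "'i \<Rightarrow> complex"
  assumes "finite I" "N > 0" and primes: "\<And>p. prime p \<Longrightarrow> p \<le> card I \<Longrightarrow> p dvd N"
    and c: "\<And>i. i \<in> I \<Longrightarrow> c i \<in> root_sums N"
    and M: "M > 0" "\<And>i. i \<in> I \<Longrightarrow> \<zeta> i ^ M = 1"
    and 0: "(\<Sum>i\<in>I. c i * \<zeta> i) = 0"
  shows "(\<Sum>i | i \<in> I \<and> \<zeta> i ^ N = \<xi>. c i * \<zeta> i) = 0"
proof -
  have conj: "(\<Sum>i\<in>I. c i * \<zeta> i ^ k) = 0" if k: "coprime k (M * N)" "[k = 1] (mod N)" for k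
  proof -
    have "\<forall>i\<in>I. \<exists>L. (\<forall>z\<in>set L. z ^ N = 1) \<and> c i = sum_list L"
      using root_sums_conv_list c by blast
    from bchoice[OF this] obtain L where
      L: "\<And>i. i \<in> I \<Longrightarrow> (\<forall>z\<in>set (L i). z ^ N = 1) \<and> c i = sum_list (L i)" by blast
    obtain xs where xs: "set xs = I" "distinct xs" using finite_distinct_list[OF assms(1)] by blast
    define LL where "LL = concat (map (\<lambda>i. map (\<lambda>\<eta>. \<eta> * \<zeta> i) (L i)) xs)"
    have sum_LL: "(\<Sum>z\<leftarrow>LL. z ^ m) = (\<Sum>i\<in>I. c i * \<zeta> i ^ m)" if "[m = 1] (mod N)" for m
    proof -
      have "(\<Sum>z\<leftarrow>LL. z ^ m) = (\<Sum>i\<leftarrow>xs. \<Sum>\<eta>\<leftarrow>L i. (\<eta> * \<zeta> i) ^ m)"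
        unfolding LL_def by (induction xs) (auto simp: o_def)
      also have "\<dots> = (\<Sum>i\<in>I. \<Sum>\<eta>\<leftarrow>L i. (\<eta> * \<zeta> i) ^ m)"
        using xs sum_list_distinct_conv_sum_set[of xs "\<lambda>i. \<Sum>\<eta>\<leftarrow>L i. (\<eta> * \<zeta> i) ^ m"] by simp
      also have "\<dots> = (\<Sum>i\<in>I. c i * \<zeta> i ^ m)"
      proof (rule sum.cong[OF refl])
        fix i assume "i \<in> I"
        have "(\<Sum>\<eta>\<leftarrow>L i. (\<eta> * \<zeta> i) ^ m) = (\<Sum>\<eta>\<leftarrow>L i. \<eta> * \<zeta> i ^ m)"
        proof (intro arg_cong[of _ _ sum_list] map_cong refl)
          fix \<eta> assume "\<eta> \<in> set (L i)"
          then have "\<eta> ^ m = \<eta>" using L[OF \<open>i \<in> I\<close>] power_cong_root[of \<eta> N m 1] that by auto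
          then show "(\<eta> * \<zeta> i) ^ m = \<eta> * \<zeta> i ^ m" by (simp add: power_mult_distrib)
        qed
        then show "(\<Sum>\<eta>\<leftarrow>L i. (\<eta> * \<zeta> i) ^ m) = c i * \<zeta> i ^ m"
          using L[OF \<open>i \<in> I\<close>] by (simp add: sum_list_mult_const)
      qed
      finally show ?thesis .
    qed
    have "\<forall>z\<in>set LL. z ^ (M * N) = 1"
    proof
      fix z assume "z \<in> set LL"
      then obtain i \<eta> where "i \<in> I" "\<eta> \<in> set (L i)" "z = \<eta> * \<zeta> i" unfolding LL_def using xs by auto
      then have "z = \<eta> * \<zeta> i" "\<eta> ^ N = 1" "\<zeta> i ^ M = 1" using L M by auto
      then show "z ^ (M * N) = 1"
        by (metis mult.commute mult.right_neutral power_mult power_mult_distrib power_one)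
    qed
    moreover have "sum_list LL = 0" using sum_LL[of 1] 0 by simp
    ultimately have "(\<Sum>z\<leftarrow>LL. z ^ k) = 0"
      using k(1) M(1) assms(2) by (intro galois_conjugation_of_root_sums[of LL "M * N"]) auto
    then show ?thesis using sum_LL[OF k(2)] by simp
  qed
  have "M * N > 0" using M(1) assms(2) by simp
  then obtain s where s: "coprime s (M * N)" "\<And>j. j < card I \<Longrightarrow> coprime (1 + j * (N * s)) (M * N)"
    using coprime_progression[OF _ assms(2) primes] by blast
  have "(\<Sum>i\<in>I. c i * \<zeta> i * (\<zeta> i ^ (N * s)) ^ j) = 0" if "j < card I" for j
  proof -
    have "[1 + j * (N * s) = 1] (mod N)"
      using cong_add_lcancel_0_nat[of 1 "j * (N * s)" N] by (simp add: cong_0_iff)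
    then have "(\<Sum>i\<in>I. c i * \<zeta> i ^ (1 + j * (N * s))) = 0" using conj s(2)[OF that] by blast
    then show ?thesis by (simp add: mult.assoc mult.left_commute mult.commute flip: power_mult)
  qed
  from moments_vanish_imp_classes_vanish[OF assms(1) this]
  have cls: "(\<Sum>i | i \<in> I \<and> \<zeta> i ^ (N * s) = \<mu>. c i * \<zeta> i) = 0" for \<mu> by blast
  have "\<zeta> i ^ (N * s) = \<xi> ^ s \<longleftrightarrow> \<zeta> i ^ N = \<xi>" if "i \<in> I" "\<xi> ^ M = 1" for i
  proof -
    have "coprime s M" using s(1) by simp
    then obtain t where t: "[s * t = 1] (mod M)" using cong_solve_coprime_nat[of s M] by auto
    have "(z ^ s) ^ t = z" if "z ^ M = 1" for z :: complex
      using power_cong_root[OF that t] by (simp add: power_mult)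
    moreover have "(\<zeta> i ^ N) ^ M = 1" using M(2)[OF that(1)] by (metis mult.commute power_mult power_one)
    ultimately show ?thesis using that(2) by (metis power_mult)
  qed
  then have "\<xi> ^ M = 1 \<Longrightarrow> {i. i \<in> I \<and> \<zeta> i ^ N = \<xi>} = {i. i \<in> I \<and> \<zeta> i ^ (N * s) = \<xi> ^ s}" by auto
  moreover have "\<xi> ^ M \<noteq> 1 \<Longrightarrow> {i. i \<in> I \<and> \<zeta> i ^ N = \<xi>} = {}"
    using M(2) by auto (metis mult.commute power_mult power_one)
  ultimately show ?thesis using cls by (cases "\<xi> ^ M = 1") (auto simp only: sum.empty simp_thms)
qed

section \<open>Rational solutions of the sine equation of a triangle\<close>

text \<open>The law of cosines for the triangle with circumdiameter 1, whose sides are the sines of its angles.\<close>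

lemma sin_law_of_cosines:
  fixes \<alpha> \<beta> \<gamma> :: real assumes "\<alpha> + \<beta> + \<gamma> = pi"
  shows "(sin \<gamma>)\<^sup>2 = (sin \<alpha>)\<^sup>2 + (sin \<beta>)\<^sup>2 - 2 * sin \<alpha> * sin \<beta> * cos \<gamma>"
proof -
  have g: "\<gamma> = pi - (\<alpha> + \<beta>)" using assms by simp
  have s: "sin \<gamma> = sin \<alpha> * cos \<beta> + cos \<alpha> * sin \<beta>" unfolding g sin_pi_minus sin_add ..
  have c: "cos \<gamma> = sin \<alpha> * sin \<beta> - cos \<alpha> * cos \<beta>" unfolding g cos_pi_minus cos_add by simp
  have 1: "(cos \<alpha>)\<^sup>2 = 1 - (sin \<alpha>)\<^sup>2" "(cos \<beta>)\<^sup>2 = 1 - (sin \<beta>)\<^sup>2" by (simp_all add: cos_squared_eq)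
  have "(sin \<gamma>)\<^sup>2 = (sin \<alpha>)\<^sup>2 * (cos \<beta>)\<^sup>2 + (cos \<alpha>)\<^sup>2 * (sin \<beta>)\<^sup>2 + 2 * sin \<alpha> * sin \<beta> * (cos \<alpha> * cos \<beta>)"
    unfolding s by (simp add: power2_eq_square algebra_simps)
  also have "\<dots> = (sin \<alpha>)\<^sup>2 + (sin \<beta>)\<^sup>2 - 2 * sin \<alpha> * sin \<beta> * cos \<gamma>"
    unfolding c 1 by (simp add: power2_eq_square algebra_simps)
  finally show ?thesis .
qed

lemma cos_neq_of_abs_less:
  fixes t \<gamma> :: real assumes "0 < \<gamma>" "\<gamma> < pi" "\<bar>t\<bar> < \<gamma>"
  shows "cos t \<noteq> cos \<gamma>"
proof -
  have "cos \<gamma> < cos \<bar>t\<bar>" using assms by (intro cos_monotone_0_pi) auto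
  then show ?thesis by simp
qed

text \<open>Two sides of a triangle, drawn as vectors whose directions differ by \<open>p + q\<close>, have a difference as long
as the third side only if \<open>cos (p + q) = cos \<gamma>\<close>.\<close>

lemma difference_of_sides_norm_neq:
  fixes \<alpha> \<beta> \<gamma> p q :: real
  assumes sum: "\<alpha> + \<beta> + \<gamma> = pi" and pos: "\<alpha> > 0" "\<beta> > 0" "\<gamma> > 0" and "\<bar>p + q\<bar> < \<gamma>"
  shows "cmod (of_real (sin \<alpha>) * cis p - of_real (sin \<beta>) * cis (- q)) \<noteq> sin \<gamma>"
proof
  assume eq: "cmod (of_real (sin \<alpha>) * cis p - of_real (sin \<beta>) * cis (- q)) = sin \<gamma>"
  have "(cmod (of_real (sin \<alpha>) * cis p - of_real (sin \<beta>) * cis (- q)))\<^sup>2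
      = (sin \<alpha> * cos p - sin \<beta> * cos q)\<^sup>2 + (sin \<alpha> * sin p + sin \<beta> * sin q)\<^sup>2"
    by (simp add: cmod_power2)
  also have "\<dots> = (sin \<alpha>)\<^sup>2 * ((cos p)\<^sup>2 + (sin p)\<^sup>2) + (sin \<beta>)\<^sup>2 * ((cos q)\<^sup>2 + (sin q)\<^sup>2)
      - 2 * sin \<alpha> * sin \<beta> * (cos p * cos q - sin p * sin q)"
    by algebra
  also have "\<dots> = (sin \<alpha>)\<^sup>2 + (sin \<beta>)\<^sup>2 - 2 * sin \<alpha> * sin \<beta> * cos (p + q)"
    by (simp add: cos_add)
  finally have "sin \<alpha> * sin \<beta> * cos (p + q) = sin \<alpha> * sin \<beta> * cos \<gamma>"
    unfolding eq using sin_law_of_cosines[OF sum] by auto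
  moreover have "sin \<alpha> > 0" "sin \<beta> > 0" using sum pos by (intro sin_gt_zero; linarith)+
  ultimately have "cos (p + q) = cos \<gamma>" by simp
  then show False using cos_neq_of_abs_less[of \<gamma> "p + q"] sum pos assms(5) by auto
qed

lemma sin_inj_triangle:
  fixes \<alpha> \<beta> :: real assumes "\<alpha> > 0" "\<beta> > 0" "\<alpha> + \<beta> < pi" "sin \<alpha> = sin \<beta>" shows "\<alpha> = \<beta>"
proof -
  have "sin \<alpha> - sin \<beta> = 2 * sin ((\<alpha> - \<beta>) / 2) * cos ((\<alpha> + \<beta>) / 2)" by (rule sin_diff_sin)
  moreover have "cos ((\<alpha> + \<beta>) / 2) > 0" using assms by (intro cos_gt_zero_pi) auto
  ultimately have "sin ((\<alpha> - \<beta>) / 2) = 0" using assms(4) by auto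
  moreover have "(\<alpha> - \<beta>) / 2 < pi" using assms(1-3) by (simp add: field_simps)
  moreover have "- ((\<alpha> - \<beta>) / 2) < pi" using assms(1-3) pi_gt_zero by (simp add: field_simps)
  ultimately have "(\<alpha> - \<beta>) / 2 = 0" using sin_gt_zero[of "(\<alpha> - \<beta>) / 2"] sin_gt_zero[of "- ((\<alpha> - \<beta>) / 2)"]
    by (cases "(\<alpha> - \<beta>) / 2" "0::real" rule: linorder_cases) auto
  then show ?thesis by simp
qed

text \<open>The part of \<open>2 \<i> a sin p = a cis p - a cis (-p)\<close> that belongs to the class of \<open>\<xi>\<close>.\<close>

definition signed_class_sum :: "complex \<Rightarrow> nat \<Rightarrow> real \<Rightarrow> real \<Rightarrow> complex" where
  "signed_class_sum \<xi> N a p = of_real a * ((if cis p ^ N = \<xi> then cis p else 0) - (if cis (- p) ^ N = \<xi> then cis (- p) else 0))"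

text \<open>If \<open>cis p\<close> and \<open>cis (-p)\<close> lie in different classes, the class of \<open>cis p\<close> has besides \<open>cis p\<close> at
most one of \<open>cis (\<plusminus>q)\<close> and one of \<open>cis (\<plusminus>r)\<close>. Neither of these alone has a coefficient of absolute
value \<open>sin \<alpha>\<close>, so both must be present. If \<open>- sin \<beta> cis (-q)\<close> or \<open>- sin \<gamma> cis (-r)\<close> occurs, the law of
cosines contradicts \<open>|p+q| < \<gamma>\<close> or \<open>|p+r| < \<beta>\<close>; otherwise all three terms have positive real part.\<close>

lemma class_sums_force_equal_powers:
  fixes \<alpha> \<beta> \<gamma> p q r :: real
  assumes sum: "\<alpha> + \<beta> + \<gamma> = pi" and pos: "\<alpha> > 0" "\<beta> > 0" "\<gamma> > 0"
    and ne: "\<alpha> \<noteq> \<beta>" "\<alpha> \<noteq> \<gamma>"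
    and lt: "\<bar>q + r\<bar> < \<alpha>" "\<bar>p + r\<bar> < \<beta>" "\<bar>p + q\<bar> < \<gamma>"
    and cls: "\<And>\<xi>. signed_class_sum \<xi> N (sin \<alpha>) p + signed_class_sum \<xi> N (sin \<beta>) q + signed_class_sum \<xi> N (sin \<gamma>) r = 0"
  shows "cis p ^ N = cis (- p) ^ N"
proof (rule ccontr)
  assume p: "cis p ^ N \<noteq> cis (- p) ^ N"
  \<comment> \<open>\<open>y\<close> and \<open>z\<close> are what \<open>q\<close> and \<open>r\<close> contribute to the class of \<open>cis p\<close>.\<close>
  define x y z where "x = of_real (sin \<alpha>) * cis p"
    and "y = signed_class_sum (cis p ^ N) N (sin \<beta>) q" and "z = signed_class_sum (cis p ^ N) N (sin \<gamma>) r"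
  have sgt: "sin \<alpha> > 0" "sin \<beta> > 0" "sin \<gamma> > 0" using sum pos by (intro sin_gt_zero; linarith)+
  have sne: "sin \<alpha> \<noteq> sin \<beta>" "sin \<alpha> \<noteq> sin \<gamma>"
    using sin_inj_triangle[of \<alpha> \<beta>] sin_inj_triangle[of \<alpha> \<gamma>] sum pos ne by auto
  have s: "x + y + z = 0" using cls[of "cis p ^ N"] p by (simp add: x_def y_def z_def signed_class_sum_def)
  have choice: "signed_class_sum (cis p ^ N) N b t \<in> {0, of_real b * cis t, - (of_real b * cis (- t))}" for b t
  proof -
    have "cis t ^ N = cis p ^ N \<Longrightarrow> cis (- t) ^ N \<noteq> cis p ^ N"
      using p by (metis cis_inverse power_inverse)
    then show ?thesis by (auto simp: signed_class_sum_def)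
  qed
  have norms: "cmod (of_real b * cis t) = b" "cmod (- (of_real b * cis t)) = b" if "b > 0" for b t
    using that by (auto simp: norm_mult)
  have cosgt: "cos p > 0" "cos q > 0" "cos r > 0" using sum lt by (intro cos_gt_zero_pi; linarith)+
  have xy: "cmod (x + y) = cmod z" using s by (metis add_eq_0_iff norm_minus_cancel)
  have xz: "cmod (x + z) = cmod y" using s by (metis add.assoc add.commute add_eq_0_iff norm_minus_cancel)
  have nx: "cmod x = sin \<alpha>" unfolding x_def using norms(1)[OF sgt(1)] .
  have y: "y \<in> {0, of_real (sin \<beta>) * cis q, - (of_real (sin \<beta>) * cis (- q))}"
    and z: "z \<in> {0, of_real (sin \<gamma>) * cis r, - (of_real (sin \<gamma>) * cis (- r))}"
    unfolding y_def z_def by (rule choice)+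
  have ny: "y = 0 \<or> cmod y = sin \<beta>" and nz: "z = 0 \<or> cmod z = sin \<gamma>"
    using y z norms[OF sgt(2)] norms[OF sgt(3)] by auto
  have "y \<noteq> 0" using xy nx nz sne sgt by auto
  moreover have "z \<noteq> 0" using xz nx ny sne sgt by auto
  ultimately have ny: "cmod y = sin \<beta>" and nz: "cmod z = sin \<gamma>" using ny nz by auto
  have "y \<noteq> - (of_real (sin \<beta>) * cis (- q))"
    using difference_of_sides_norm_neq[OF sum pos lt(3)] xy nz by (auto simp: x_def)
  moreover have "z \<noteq> - (of_real (sin \<gamma>) * cis (- r))"
    using difference_of_sides_norm_neq[of \<alpha> \<gamma> \<beta> p r] sum pos lt(2) xz ny by (auto simp: x_def)
  ultimately have yz: "y = of_real (sin \<beta>) * cis q" "z = of_real (sin \<gamma>) * cis r"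
    using y z \<open>y \<noteq> 0\<close> \<open>z \<noteq> 0\<close> by auto
  have "Re (x + y + z) = sin \<alpha> * cos p + sin \<beta> * cos q + sin \<gamma> * cos r" unfolding yz x_def by simp
  moreover have "\<dots> > 0" using sgt cosgt by (intro add_pos_pos mult_pos_pos)
  ultimately show False using s by simp
qed

lemma cis_power_eq_imp_multiple:
  assumes "cis p ^ N = cis (- p) ^ N" "N > 0"
  obtains P :: int where "p = of_int P * pi / of_nat N"
proof -
  have "cis (of_nat N * p) = cis (- (of_nat N * p))" using assms(1) by (simp add: Complex.DeMoivre)
  then have "sin (of_nat N * p) = 0" by (metis complex.inject cis.code sin_minus minus_equation_iff neg_equal_zero)
  then obtain P :: int where "of_nat N * p = of_int P * pi" using sin_zero_iff_int2 by blast
  then show thesis using that assms(2) by (simp add: field_simps)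
qed

lemma sin_in_root_sums:
  assumes "cis \<alpha> ^ N = 1" "even N"
  shows "2 * \<i> * of_real (sin \<alpha>) \<in> root_sums N"
proof -
  have "2 * \<i> * of_real (sin \<alpha>) = cis \<alpha> + - cis (- \<alpha>)" by (simp add: complex_eq_iff)
  moreover have "cis (- \<alpha>) ^ N = 1" using assms(1) by (metis cis_inverse inverse_1 power_inverse)
  then have "(- cis (- \<alpha>)) ^ N = 1" using assms(2) by simp
  ultimately show ?thesis using root_sums_add[OF root_sums_root[OF assms(1)] root_sums_root] by metis
qed

text \<open>The sine equation as a vanishing sum of six roots of unity with coefficients \<open>\<plusminus> 2 \<i> sin \<alpha>\<close> and so on,
split into classes. The coefficients are differences of two N-th roots of unity.\<close>

lemma signed_class_sums_vanish:
  fixes \<alpha> \<beta> \<gamma> p q r :: real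
  assumes N: "N > 0" "30 dvd N" and M: "M > 0" "cis p ^ M = 1" "cis q ^ M = 1" "cis r ^ M = 1"
    and abc: "cis \<alpha> ^ N = 1" "cis \<beta> ^ N = 1" "cis \<gamma> ^ N = 1"
    and eq: "sin \<alpha> * sin p + sin \<beta> * sin q + sin \<gamma> * sin r = 0"
  shows "signed_class_sum \<xi> N (sin \<alpha>) p + signed_class_sum \<xi> N (sin \<beta>) q + signed_class_sum \<xi> N (sin \<gamma>) r = 0"
proof -
  \<comment> \<open>Index \<open>2 k\<close> carries the exponential with the positive sign, \<open>2 k + 1\<close> its conjugate.\<close>
  define a where "a i = (if i < 2 then sin \<alpha> else if i < 4 then sin \<beta> else sin \<gamma>)" for i :: nat
  define t where "t i = (if i < 2 then p else if i < 4 then q else r)" for i :: nat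
  define c where "c i = 2 * \<i> * of_real (a i) * (- 1) ^ i" for i :: nat
  define \<zeta> where "\<zeta> i = cis ((- 1) ^ i * t i)" for i
  have even: "even N" using N(2) by (metis dvd_trans even_numeral)
  have dvd: "prime p \<Longrightarrow> p \<le> 6 \<Longrightarrow> p dvd N" for p
  proof -
    assume p: "prime p" "p \<le> 6"
    have "p \<noteq> 4" using p(1) prime_product[of 2 2] by auto
    moreover have "p \<noteq> 6" using p(1) prime_product[of 2 3] by auto
    moreover have "p > 1" using p(1) prime_gt_1_nat by blast
    ultimately have "p \<in> {2, 3, 5}" using p(2) by auto
    then have "p dvd 30" by auto
    then show "p dvd N" using N(2) dvd_trans by blast
  qed
  have minus: "- x \<in> root_sums N" if "x \<in> root_sums N" for x
    using root_sums_root_mult[OF that, of "-1"] even by simp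
  have six: "{..<6::nat} = {0,1,2,3,4,5}" by auto
  have "(\<Sum>i | i \<in> {..<6} \<and> \<zeta> i ^ N = \<xi>. c i * \<zeta> i) = 0"
  proof (rule vanishing_sum_splits_into_classes[OF _ N(1) _ _ M(1)])
    fix i :: nat
    have "2 * \<i> * of_real (a i) \<in> root_sums N"
      unfolding a_def using abc even by (auto intro: sin_in_root_sums)
    then show "c i \<in> root_sums N"
      unfolding c_def using minus by (cases "even i") auto
    have "cis (t i) ^ M = 1" using M unfolding t_def by auto
    moreover have "cis (- t i) ^ M = 1" using calculation by (metis cis_inverse inverse_1 power_inverse)
    ultimately show "\<zeta> i ^ M = 1" unfolding \<zeta>_def by (cases "even i") auto
  next
    have "(\<Sum>i<6. c i * \<zeta> i) = 2 * \<i> * (2 * \<i>) * of_real (sin \<alpha> * sin p + sin \<beta> * sin q + sin \<gamma> * sin r)"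
      unfolding six by (simp add: c_def \<zeta>_def a_def t_def complex_eq_iff algebra_simps)
    then show "(\<Sum>i<6. c i * \<zeta> i) = 0" unfolding eq by simp
  qed (use dvd in auto)
  then have "(\<Sum>i<6. if \<zeta> i ^ N = \<xi> then c i * \<zeta> i else 0) = 0"
    by (subst (asm) sum.inter_filter) auto
  moreover have "(\<Sum>i<6. if \<zeta> i ^ N = \<xi> then c i * \<zeta> i else 0)
     = 2 * \<i> * (signed_class_sum \<xi> N (sin \<alpha>) p + signed_class_sum \<xi> N (sin \<beta>) q + signed_class_sum \<xi> N (sin \<gamma>) r)"
    unfolding six by (simp add: c_def \<zeta>_def a_def t_def signed_class_sum_def algebra_simps)
  ultimately show ?thesis by simp
qed

lemma rational_multiple_of_pi_root_of_unity:
  assumes "rational_multiple_of_pi p"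
  shows "\<exists>M>0. cis p ^ M = 1"
proof -
  obtain x where x: "x \<in> \<rat>" "p = x * pi" using assms by (auto simp: rational_multiple_of_pi_def)
  then obtain a b :: int where ab: "b > 0" "x = of_int a / of_int b" by (metis Rats_cases')
  have "of_nat (nat (2 * b)) * p = 2 * pi * of_int a" using ab x(2) by (simp add: field_simps)
  then have "cis p ^ nat (2 * b) = 1" using cis_multiple_2pi[of "of_int a"] by (simp add: Complex.DeMoivre)
  then show ?thesis using ab(1) by (intro exI[of _ "nat (2 * b)"]) auto
qed

lemma cis_power_int_multiple:
  assumes "N > 0"
  shows "cis (of_int P * pi / of_nat N) ^ N = (if even P then 1 else - 1)"
proof -
  have "cis (of_int P * pi / of_nat N) ^ N = cis (of_int P * pi)" using assms by (simp add: Complex.DeMoivre)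
  also have "\<dots> = (if even P then 1 else - 1)"
    by (auto simp: complex_eq_iff cos_int_times_real sin_int_times_real mult.commute elim!: evenE oddE)
  finally show ?thesis .
qed

text \<open>Once \<open>p, q, r\<close> are known to be multiples of \<open>pi / N\<close>, the class of \<open>\<xi> = -1\<close> consists of both
exponentials of the odd ones. This gives the last conclusion.\<close>

theorem rational_solutions_have_bounded_denominator:
  fixes \<alpha> \<beta> \<gamma> p q r :: real
  assumes sum: "\<alpha> + \<beta> + \<gamma> = pi" and pos: "\<alpha> > 0" "\<beta> > 0" "\<gamma> > 0"
    and ne: "\<alpha> \<noteq> \<beta>" "\<alpha> \<noteq> \<gamma>" "\<beta> \<noteq> \<gamma>"
    and lt: "\<bar>q + r\<bar> < \<alpha>" "\<bar>p + r\<bar> < \<beta>" "\<bar>p + q\<bar> < \<gamma>"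
    and N: "N > 0" "30 dvd N"
    and abc: "cis \<alpha> ^ N = 1" "cis \<beta> ^ N = 1" "cis \<gamma> ^ N = 1"
    and rat: "rational_multiple_of_pi p" "rational_multiple_of_pi q" "rational_multiple_of_pi r"
    and eq: "sin \<alpha> * sin p + sin \<beta> * sin q + sin \<gamma> * sin r = 0"
  obtains P Q R :: int where "p = of_int P * pi / of_nat N" "q = of_int Q * pi / of_nat N" "r = of_int R * pi / of_nat N"
    "(if odd P then sin \<alpha> * sin p else 0) + (if odd Q then sin \<beta> * sin q else 0)
      + (if odd R then sin \<gamma> * sin r else 0) = 0"
proof -
  obtain M1 M2 M3 where "M1 > 0" "M2 > 0" "M3 > 0" "cis p ^ M1 = 1" "cis q ^ M2 = 1" "cis r ^ M3 = 1"
    using rat[THEN rational_multiple_of_pi_root_of_unity] by blast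
  then have M: "M1 * M2 * M3 > 0" "cis p ^ (M1 * M2 * M3) = 1" "cis q ^ (M1 * M2 * M3) = 1" "cis r ^ (M1 * M2 * M3) = 1"
    by (simp, metis mult.assoc power_mult power_one, metis mult.assoc mult.commute power_mult power_one, metis mult.commute power_mult power_one)
  note cls = signed_class_sums_vanish[OF N M abc eq]
  obtain P :: int where P: "p = of_int P * pi / of_nat N"
    using class_sums_force_equal_powers[OF sum pos ne(1,2) lt cls] cis_power_eq_imp_multiple N(1) by blast
  obtain Q :: int where Q: "q = of_int Q * pi / of_nat N"
    using class_sums_force_equal_powers[of \<beta> \<alpha> \<gamma> p r q N] sum pos ne lt cls cis_power_eq_imp_multiple[OF _ N(1)]
    by (smt (verit, ccfv_threshold) add.commute)
  obtain R :: int where R: "r = of_int R * pi / of_nat N"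
    using class_sums_force_equal_powers[of \<gamma> \<alpha> \<beta> p q r N] sum pos ne lt cls cis_power_eq_imp_multiple[OF _ N(1)]
    by (smt (verit, ccfv_threshold) add.commute add.left_commute)
  have ct: "signed_class_sum (- 1) N a t = 2 * \<i> * of_real (if odd T then a * sin t else 0)"
    if "t = of_int T * pi / of_nat N" for t T a
  proof -
    have "- t = of_int (- T) * pi / of_nat N" using that by simp
    then have "cis t ^ N = (if even T then 1 else - 1)" "cis (- t) ^ N = (if even T then 1 else - 1)"
      using that cis_power_int_multiple[OF N(1), of T] cis_power_int_multiple[OF N(1), of "- T"] by auto
    then show ?thesis unfolding signed_class_sum_def by (auto simp: complex_eq_iff)
  qed
  have "2 * \<i> * of_real ((if odd P then sin \<alpha> * sin p else 0) + (if odd Q then sin \<beta> * sin q else 0)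
      + (if odd R then sin \<gamma> * sin r else 0)) = 0"
    using cls[of "- 1"] unfolding ct[OF P] ct[OF Q] ct[OF R] by (simp only: of_real_add distrib_left)
  then have "(if odd P then sin \<alpha> * sin p else 0) + (if odd Q then sin \<beta> * sin q else 0)
      + (if odd R then sin \<gamma> * sin r else 0) = 0" by (simp only: mult_eq_0_iff of_real_eq_0_iff) simp
  then show thesis using that P Q R by blast
qed

section \<open>A one-parameter family of triangles without nontrivial solutions\<close>

lemma sin_treble_sin:
  fixes t :: real shows "sin (3 * t) = (3 - 4 * (sin t)\<^sup>2) * sin t"
proof -
  have "sin (3 * t) = sin (2 * t) * cos t + cos (2 * t) * sin t" using sin_add[of "2 * t" t] by simp
  also have "\<dots> = 2 * sin t * (cos t)\<^sup>2 + (1 - 2 * (sin t)\<^sup>2) * sin t"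
    by (simp add: sin_double cos_double_sin power2_eq_square)
  also have "\<dots> = (3 - 4 * (sin t)\<^sup>2) * sin t" by (simp add: cos_squared_eq algebra_simps)
  finally show ?thesis .
qed

text \<open>This is the sine equation for \<open>u = 0\<close> and \<open>v = s\<close>, where \<open>p = 2 s - r\<close> and \<open>q = - r\<close>. After division
by \<open>2 sin s\<close> it reads \<open>h r = 0\<close>, where \<open>h t / cos t\<close> decreases. Its zero lies strictly between the
neighbouring grid points \<open>pi/2 - 5 s\<close> and \<open>pi/2 - 4 s\<close>, so no grid point is a solution. The margin is
narrow: \<open>h (pi/2 - 5 s)\<close> is only of the fourth order in \<open>s\<close>.\<close>

lemma shifted_pair_not_solution:
  fixes s r :: real
  assumes s: "0 < s" "30 * s \<le> pi" and r: "\<bar>r\<bar> < pi / 2" and Rk: "r = pi / 2 - of_int k * s"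
  shows "sin (2 * s) * sin (2 * s - r) + (sin (6 * s) - sin (4 * s)) * sin r \<noteq> 0"
proof
  assume eq: "sin (2 * s) * sin (2 * s - r) + (sin (6 * s) - sin (4 * s)) * sin r = 0"
  define h where "h t = cos s * sin (2 * s - t) + cos (5 * s) * sin t" for t
  have ss: "sin s > 0" using s by (intro sin_gt_zero) auto
  have "sin (6 * s) - sin (4 * s) = 2 * sin s * cos (5 * s)" using sin_diff_sin[of "6 * s" "4 * s"] by simp
  then have "2 * sin s * h r = 0" using eq sin_double[of s] unfolding h_def by algebra
  then have hr: "h r = 0" using ss by simp
  define K where "K = cos s * cos (2 * s) - cos (5 * s)"
  have h_alt: "h t = sin (2 * s) * cos s * cos t - K * sin t" for t
    by (simp add: h_def K_def sin_diff algebra_simps)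
  have cmp: "h a * cos b > h b * cos a" if "a < b" "b - a < pi" for a b
  proof -
    have "h a * cos b - h b * cos a = K * (sin b * cos a - cos b * sin a)" by (simp add: h_alt algebra_simps)
    also have "\<dots> = K * sin (b - a)" by (simp add: sin_diff)
    also have "\<dots> > 0"
    proof (intro mult_pos_pos sin_gt_zero)
      have "cos (5 * s) < cos (3 * s)" "cos (3 * s) < cos s" using s by (intro cos_monotone_0_pi; linarith)+
      moreover have "cos s * cos (2 * s) = (cos s + cos (3 * s)) / 2"
        using cos_plus_cos[of s "3 * s"] cos_plus_cos[of "3 * s" s] by simp
      ultimately show "K > 0" unfolding K_def by simp
    qed (use that in auto)
    finally show ?thesis by simp
  qed
  have h5: "h (pi / 2 - 5 * s) > 0"
  proof -
    have t: "sin (2 * s - (pi / 2 - 5 * s)) = - cos (7 * s)" "sin (pi / 2 - 5 * s) = cos (5 * s)"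
      using sin_diff[of "7 * s" "pi / 2"] by (simp_all add: sin_diff algebra_simps)
    have "2 * h (pi / 2 - 5 * s) = 1 + cos (10 * s) - cos (8 * s) - cos (6 * s)"
      using cos_double_cos[of "5 * s"] cos_plus_cos[of "8 * s" "6 * s"]
      unfolding h_def t by (simp add: power2_eq_square algebra_simps)
    also have "\<dots> = 2 * ((sin (3 * s))\<^sup>2 - sin (9 * s) * sin s)"
      using cos_double_sin[of "3 * s"] cos_diff_cos[of "10 * s" "8 * s"] by (simp add: algebra_simps)
    also have "\<dots> > 0"
    proof -
      have t3: "sin (3 * s) = (3 - 4 * (sin s)\<^sup>2) * sin s" by (rule sin_treble_sin)
      have t9: "sin (9 * s) = (3 - 4 * (sin (3 * s))\<^sup>2) * sin (3 * s)"
        using sin_treble_sin[of "3 * s"] by simp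
      have "sin s < sin (3 * s)" using s by (intro sin_monotone_2pi) auto
      then have "(sin s)\<^sup>2 < (sin (3 * s))\<^sup>2" using ss by (intro power_strict_mono) auto
      then have "(3 - 4 * (sin (3 * s))\<^sup>2) * sin s < (3 - 4 * (sin s)\<^sup>2) * sin s" using ss by simp
      then have "sin (3 * s) * ((3 - 4 * (sin (3 * s))\<^sup>2) * sin s) < sin (3 * s) * sin (3 * s)"
        using \<open>sin s < sin (3 * s)\<close> ss unfolding t3[symmetric] by (intro mult_strict_left_mono) auto
      then show ?thesis unfolding t9 by (simp add: power2_eq_square algebra_simps)
    qed
    finally show ?thesis by simp
  qed
  have h4: "h (pi / 2 - 4 * s) < 0"
  proof -
    have t: "sin (2 * s - (pi / 2 - 4 * s)) = - cos (6 * s)" "sin (pi / 2 - 4 * s) = cos (4 * s)"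
      using sin_diff[of "6 * s" "pi / 2"] by (simp_all add: sin_diff algebra_simps)
    have "2 * h (pi / 2 - 4 * s) = cos (9 * s) + cos s - cos (7 * s) - cos (5 * s)"
      using cos_plus_cos[of "7 * s" "5 * s"] cos_plus_cos[of "9 * s" "s"]
      unfolding h_def t by (simp add: algebra_simps)
    also have "\<dots> = 2 * sin s * (sin (4 * s) + sin (2 * s) - sin (8 * s))"
      using cos_diff_cos[of "9 * s" "7 * s"] cos_diff_cos[of "3 * s" s] cos_diff_cos[of "5 * s" "3 * s"]
      by (simp add: algebra_simps)
    also have "\<dots> < 0"
    proof -
      have "sin (8 * s) - sin (2 * s) = 2 * cos (5 * s) * sin (3 * s)"
        using sin_diff_sin[of "8 * s" "2 * s"] by simp
      moreover have "cos (pi / 6) \<le> cos (5 * s)" using s by (intro cos_monotone_0_pi_le) auto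
      then have "sqrt 3 \<le> 2 * cos (5 * s)" by (simp add: cos_30)
      moreover have "sqrt 3 \<ge> 1.7" by (rule real_le_rsqrt) (simp add: power2_eq_square)
      ultimately have c5: "2 * cos (5 * s) \<ge> 1.7" by linarith
      have s3: "sin (3 * s) > 0" using s by (intro sin_gt_zero) auto
      have c1: "cos s \<ge> 0" using s by (intro less_imp_le cos_gt_zero_pi) auto
      have "sin (4 * s) = sin (3 * s) * cos s + cos (3 * s) * sin s" using sin_add[of "3 * s" s] by simp
      also have "\<dots> \<le> sin (3 * s) * 1 + 1 * sin s" using s3 ss c1 by (intro add_mono mult_mono) auto
      finally have s4: "sin (4 * s) \<le> sin (3 * s) + sin s" by simp
      have "sin s \<le> sin (pi / 6)" using s by (intro sin_monotone_2pi_le) auto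
      then have "(sin s)\<^sup>2 \<le> (1 / 2)\<^sup>2" using ss by (intro power_mono) (auto simp: sin_30)
      then have "2 * sin s \<le> (3 - 4 * (sin s)\<^sup>2) * sin s" using ss by (intro mult_right_mono) (auto simp: power2_eq_square)
      also have "\<dots> = sin (3 * s)" by (rule sin_treble_sin[symmetric])
      finally have "2 * sin s \<le> sin (3 * s)" .
      moreover have "1.7 * sin (3 * s) \<le> 2 * cos (5 * s) * sin (3 * s)" using c5 s3 by (intro mult_right_mono) auto
      ultimately have "sin (4 * s) + sin (2 * s) - sin (8 * s) < 0"
        using s4 s3 \<open>sin (8 * s) - sin (2 * s) = _\<close> by linarith
      then show ?thesis using ss by (simp add: mult_pos_neg)
    qed
    finally show ?thesis by simp
  qed
  have cosr: "cos r > 0" using r by (intro cos_gt_zero_pi) auto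
  show False
  proof (cases "k \<ge> 5")
    case True
    then have "r \<le> pi / 2 - 5 * s" using s(1) Rk by (simp add: mult_right_mono)
    moreover have "r \<noteq> pi / 2 - 5 * s" using hr h5 by auto
    ultimately have "h r * cos (pi / 2 - 5 * s) > h (pi / 2 - 5 * s) * cos r"
      using r s(1) by (intro cmp) auto
    then show False using hr h5 cosr by (simp add: mult_less_0_iff)
  next
    case False
    then have "of_int k * s \<le> 4 * s" using s(1) by (intro mult_right_mono) auto
    then have "r \<ge> pi / 2 - 4 * s" using Rk by simp
    moreover have "r \<noteq> pi / 2 - 4 * s" using hr h4 by auto
    ultimately have "h (pi / 2 - 4 * s) * cos r > h r * cos (pi / 2 - 4 * s)"
      using r s by (intro cmp) auto
    then show False using hr h4 cosr by (simp add: zero_less_mult_iff)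
  qed
qed

lemma sin_eq_0_imp_eq_0:
  fixes t :: real assumes "sin t = 0" "\<bar>t\<bar> < pi / 2" shows "t = 0"
  using sin_gt_zero[of t] sin_gt_zero[of "- t"] assms
  by (cases t "0::real" rule: linorder_cases) auto

text \<open>In units of \<open>s = pi / N\<close> the unknowns are integers \<open>P, Q, R\<close> with \<open>|Q+R| < 2\<close> and \<open>|P+R| < 4\<close>, and the odd
and the even ones satisfy the equation separately. If all parities agree, then \<open>Q = - R\<close> and
\<open>P + R\<close> is \<open>0\<close> or \<open>\<plusminus>2\<close>: in the first case all sines agree up to sign and the strict triangle inequality
applies, the second is the shifted case excluded above. If one parity occurs only once, the unknown with that parity is 0.
Then it is even, and the two odd ones satisfy a two-term equation that the bounds reduce to comparisons of sines of
\<open>s, 2 s, 3 s, 4 s, 6 s\<close>.\<close>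

lemma special_triangle_only_trivial_solution:
  fixes s p q r :: real
  assumes N: "N > 0" "30 dvd N" and s_def: "s = pi / of_nat N"
    and lt: "\<bar>q + r\<bar> < 2 * s" "\<bar>p + r\<bar> < 4 * s" "\<bar>p + q\<bar> < pi - 6 * s"
    and rat: "rational_multiple_of_pi p" "rational_multiple_of_pi q" "rational_multiple_of_pi r"
    and eq: "sin (2 * s) * sin p + sin (4 * s) * sin q + sin (pi - 6 * s) * sin r = 0"
  shows "p = 0 \<and> q = 0 \<and> r = 0"
proof -
  have N30: "N \<ge> 30" using N dvd_imp_le by blast
  have s0: "s > 0" using N(1) by (simp add: s_def)
  have Ns: "of_nat N * s = pi" using N(1) by (simp add: s_def)
  have "30 * s \<le> of_nat N * s" using N30 s0 by (intro mult_right_mono) auto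
  then have s30: "30 * s \<le> pi" using Ns by simp
  have even: "even N" using N(2) by (metis dvd_trans even_numeral)
  then obtain n where n: "N = 2 * n" by blast
  have cis1: "cis (2 * of_nat j * s) ^ N = 1" for j
  proof -
    have "of_nat N * (2 * of_nat j * s) = 2 * of_nat j * (of_nat N * s)" by simp
    also have "\<dots> = 2 * pi * of_nat j" unfolding Ns by simp
    finally have "cis (2 * of_nat j * s) ^ N = cis (2 * pi * of_nat j)" by (simp only: Complex.DeMoivre)
    then show ?thesis using cis_multiple_2pi[of "of_nat j"] by simp
  qed
  have "cis (2 * s) ^ N = 1" "cis (4 * s) ^ N = 1" using cis1[of 1] cis1[of 2] by auto
  moreover have "pi - 6 * s = 2 * of_nat (n - 3) * s"
  proof -
    have "n \<ge> 3" using N30 n by auto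
    then show ?thesis using Ns by (simp add: n of_nat_diff algebra_simps)
  qed
  then have "cis (pi - 6 * s) ^ N = 1" using cis1[of "n - 3"] by simp
  ultimately obtain P Q R :: int where "p = of_int P * pi / of_nat N" "q = of_int Q * pi / of_nat N" "r = of_int R * pi / of_nat N"
    and odd: "(if odd P then sin (2 * s) * sin p else 0) + (if odd Q then sin (4 * s) * sin q else 0)
      + (if odd R then sin (pi - 6 * s) * sin r else 0) = 0"
    using rational_solutions_have_bounded_denominator[of "2 * s" "4 * s" "pi - 6 * s" q r p N]
      lt rat eq s0 s30 N by auto
  then have pqr: "p = of_int P * s" "q = of_int Q * s" "r = of_int R * s" by (auto simp: s_def)
  have small: "\<bar>p\<bar> < pi / 2" "\<bar>q\<bar> < pi / 2" "\<bar>r\<bar> < pi / 2" using lt by linarith+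
  have int_lt: "\<bar>k\<bar> < j" if "\<bar>of_int k * s\<bar> < of_int j * s" for k j :: int
    using that s0 by (simp add: abs_mult)
  have QR: "\<bar>Q + R\<bar> < 2" and PR: "\<bar>P + R\<bar> < 4"
    using lt(1,2) int_lt[of "Q + R" 2] int_lt[of "P + R" 4] unfolding pqr by (auto simp: distrib_right)
  then have QR: "- 2 < Q + R" "Q + R < 2" and PR: "- 4 < P + R" "P + R < 4" by linarith+
  have zero: "T = 0" if "sin (of_int T * s) = 0" "\<bar>of_int T * s\<bar> < pi / 2" for T :: int
    using sin_eq_0_imp_eq_0[OF that] s0 by simp
  define a b c d e where "a = sin (2 * s)" and "b = sin (4 * s)" and "c = sin (6 * s)" and "d = sin s" and "e = sin (3 * s)"
  have abc: "0 < a" "a < b" "b < c" "0 < d" "0 < e" unfolding a_def b_def c_def d_def e_def using s0 s30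
    by (auto intro!: sin_gt_zero sin_monotone_2pi)
  have bc0: "b > 0" "c > 0" using abc by auto
  have cc: "sin (pi - 6 * s) = c" by (simp add: c_def)
  have cos_lt: "cos (3 * s) < cos s" using s0 s30 by (intro cos_monotone_0_pi) auto
  have c_eq: "c = 2 * e * cos (3 * s)" unfolding c_def e_def using sin_double[of "3 * s"] by simp
  have a_eq: "a = 2 * d * cos s" unfolding a_def d_def by (rule sin_double)
  have "a * e - c * d = 2 * d * e * (cos s - cos (3 * s))" unfolding c_eq a_eq by (simp add: algebra_simps)
  then have ae_cd: "a * e \<noteq> c * d" using abc cos_lt by auto
  have "b = 2 * a * cos (2 * s)" unfolding a_def b_def using sin_double[of "2 * s"] by simp
  moreover have "e - d = 2 * d * cos (2 * s)" unfolding e_def d_def using sin_diff_sin[of "3 * s" s] by simp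
  ultimately have "b * d = a * (e - d)" by simp
  then have "a * e = b * d + a * d" by (simp add: algebra_simps)
  moreover have "a * d > 0" using abc by simp
  ultimately have ae_bd: "a * e \<noteq> b * d" by linarith
  have "a + b = 2 * e * cos s" unfolding a_def b_def e_def using sin_plus_sin[of "4 * s" "2 * s"] by simp
  then have "a + b - c = 2 * e * (cos s - cos (3 * s))" unfolding c_eq by (simp add: algebra_simps)
  then have tri: "a + b - c \<noteq> 0" using abc cos_lt by auto
  have sins: "sin (of_int 1 * s) = d" "sin (of_int 3 * s) = e" "sin (of_int (-1) * s) = - d" "sin (of_int (-3) * s) = - e"
    by (simp_all add: d_def e_def)
  \<comment> \<open>The full equation and its odd part.\<close>
  have E: "a * sin p + b * sin q + c * sin r = 0" using eq unfolding cc a_def b_def .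
  have O: "(if odd P then a * sin p else 0) + (if odd Q then b * sin q else 0) + (if odd R then c * sin r else 0) = 0"
    using odd unfolding cc a_def b_def .
  have zP: "sin p = 0 \<Longrightarrow> P = 0" and zQ: "sin q = 0 \<Longrightarrow> Q = 0" and zR: "sin r = 0 \<Longrightarrow> R = 0"
    using zero small unfolding pqr by blast+
  have same: False if "even (Q + R)" "even (P + R)" "\<not> (P = 0 \<and> Q = 0 \<and> R = 0)"
  proof -
    have QR: "Q = - R" using QR that(1) by presburger
    have q: "q = - r" unfolding pqr QR by simp
    have "P + R = - 2 \<or> P + R = 0 \<or> P + R = 2" using PR that(2) by presburger
    then consider "P = - R" | "P = 2 - R" | "P = - 2 - R" by force
    then show False
    proof cases
      case 1
      then have "p = - r" unfolding pqr by simp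
      then have "(a + b - c) * sin r = 0" using E q by (simp add: algebra_simps)
      then have "R = 0" using tri zR by simp
      then show False using 1 QR that(3) by simp
    next
      case 2
      have p: "p = 2 * s - r" unfolding pqr 2 by (simp add: algebra_simps)
      have "r = pi / 2 - of_int (int n - R) * s" using Ns unfolding pqr n by (simp add: algebra_simps)
      from shifted_pair_not_solution[OF s0 s30 small(3) this] show False
        using E unfolding p q a_def b_def c_def by (simp add: algebra_simps)
    next
      case 3
      have p: "p = - (2 * s - (- r))" unfolding pqr 3 by (simp add: algebra_simps)
      have r': "- r = pi / 2 - of_int (int n + R) * s" using Ns unfolding pqr n by (simp add: algebra_simps)
      have "sin p = - sin (2 * s - (- r))" unfolding p by (rule sin_minus)
      with shifted_pair_not_solution[OF s0 s30 _ r'] show False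
        using E small(3) unfolding q a_def b_def c_def by (simp add: algebra_simps)
    qed
  qed
  have "P = 0 \<and> Q = 0 \<and> R = 0"
  proof (rule ccontr)
    assume nz: "\<not> (P = 0 \<and> Q = 0 \<and> R = 0)"
    consider "even (Q + R)" "even (P + R)" | "odd P" "even Q" "even R" | "even P" "odd Q" "even R" | "even P" "even Q" "odd R"
      | "even P" "odd Q" "odd R" | "odd P" "even Q" "odd R" | "odd P" "odd Q" "even R" by auto
    then show False
    proof cases
      case 1 then show False using same nz by blast
    next
      case 2 then show False using O zP abc by auto
    next
      case 3 then show False using O zQ bc0 by auto
    next
      case 4 then show False using O zR bc0 by auto
    next
      case 5
      then have "Q = - R" using QR by presburger
      then have "(c - b) * sin r = 0" using O 5 unfolding pqr by (simp add: algebra_simps)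
      then show False using abc zR 5 by auto
    next
      case 6
      then have O6: "a * sin p + c * sin r = 0" using O by simp
      then have "b * sin q = 0" using E by linarith
      then have "Q = 0" using bc0 zQ by simp
      then have "R = 1 \<or> R = - 1" using QR 6 by presburger
      moreover have "P + R = - 2 \<or> P + R = 0 \<or> P + R = 2" using PR 6 by presburger
      ultimately have combos: "(P, R) \<in> {(-3, 1), (-1, 1), (1, 1), (-1, -1), (1, -1), (3, -1)}" by force
      have "a * e = c * d \<or> a * d = c * d \<or> a * d + c * d = 0"
        using combos O6 unfolding pqr by (auto simp only: insert_iff prod.inject sins empty_iff)
      moreover have "a * d + c * d > 0" using abc bc0 by (intro add_pos_pos mult_pos_pos)
      ultimately show False using ae_cd abc by auto
    next
      case 7
      then have O7: "a * sin p + b * sin q = 0" using O by simp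
      then have "c * sin r = 0" using E by linarith
      then have "R = 0" using bc0 zR by simp
      then have "Q = 1 \<or> Q = - 1" using QR 7 by presburger
      moreover have "P = - 3 \<or> P = - 1 \<or> P = 1 \<or> P = 3" using PR 7 \<open>R = 0\<close> by presburger
      ultimately have combos: "(P, Q) \<in> {-3, -1, 1, 3} \<times> {-1, 1}" by force
      have "a * e = b * d \<or> a * d = b * d \<or> a * d + b * d = 0 \<or> a * e + b * d = 0"
        using combos O7 unfolding pqr by (auto simp only: insert_iff mem_Times_iff fst_conv snd_conv sins empty_iff)
      moreover have "a * d + b * d > 0" "a * e + b * d > 0" using abc bc0 by (auto intro!: add_pos_pos mult_pos_pos)
      ultimately show False using ae_bd abc by auto
    qed
  qed
  then show ?thesis unfolding pqr by simp
qed

section \<open>Angles in the plane\<close>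

definition vangle :: "point \<Rightarrow> point \<Rightarrow> real" where
  "vangle u v = arccos (u \<bullet> v / (norm u * norm v))"

definition cross :: "point \<Rightarrow> point \<Rightarrow> real" where
  "cross u v = u $ 1 * v $ 2 - u $ 2 * v $ 1"

lemma angle_eq_vangle: "angle X Y Z = vangle (X - Y) (Z - Y)"
  by (simp add: angle_def vangle_def)

lemma inner_point: "u \<bullet> v = u $ 1 * v $ 1 + u $ 2 * v $ 2" for u v :: point
  by (simp add: inner_vec_def sum_2)

lemma lagrange_identity: "(u \<bullet> v)\<^sup>2 + (cross u v)\<^sup>2 = (norm u * norm v)\<^sup>2"
  unfolding power_mult_distrib power2_norm_eq_inner
  by (simp add: inner_point cross_def power2_eq_square algebra_simps)

lemma cross_nonzero_imp: "cross u v \<noteq> 0 \<Longrightarrow> u \<noteq> 0 \<and> v \<noteq> 0"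
  by (auto simp: cross_def)

lemma collinear_iff_cross: "collinear {0, u, v} \<longleftrightarrow> cross u v = 0"
proof -
  have "collinear {0, u, v} \<longleftrightarrow> (u \<bullet> v)\<^sup>2 = (norm u * norm v)\<^sup>2"
    unfolding norm_cauchy_schwarz_equal[symmetric] using power2_eq_iff_nonneg[of "\<bar>u \<bullet> v\<bar>" "norm u * norm v"] by auto
  then show ?thesis using lagrange_identity[of u v] by auto
qed

lemma triangle_iff_cross: "triangle A B C \<longleftrightarrow> cross (B - A) (C - A) \<noteq> 0"
proof -
  have "collinear {A, B, C} \<longleftrightarrow> collinear {B, A, C}" by (simp add: insert_commute)
  also have "\<dots> \<longleftrightarrow> collinear {0, B - A, C - A}" by (rule collinear_3) (simp add: NO_MATCH_def)
  finally show ?thesis unfolding triangle_def collinear_iff_cross by simp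
qed

lemma normalised_inner_bounds:
  fixes u v :: point
  shows "- 1 \<le> u \<bullet> v / (norm u * norm v)" "u \<bullet> v / (norm u * norm v) \<le> 1"
proof -
  have "\<bar>u \<bullet> v / (norm u * norm v)\<bar> \<le> 1"
    using Cauchy_Schwarz_ineq2[of u v] by (cases "u = 0 \<or> v = 0") (auto simp: abs_divide divide_le_eq)
  then show "- 1 \<le> u \<bullet> v / (norm u * norm v)" "u \<bullet> v / (norm u * norm v) \<le> 1"
    by (simp_all only: abs_le_iff) linarith+
qed

lemma cos_vangle:
  assumes "u \<noteq> 0" "v \<noteq> 0" shows "cos (vangle u v) * (norm u * norm v) = u \<bullet> v"
  using assms normalised_inner_bounds[of u v] unfolding vangle_def by (simp add: cos_arccos)

lemma vangle_range: "0 \<le> vangle u v" "vangle u v \<le> pi"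
  unfolding vangle_def using normalised_inner_bounds[of u v] by (auto intro: arccos_lbound arccos_ubound)

lemma vangle_eqI:
  assumes "u \<noteq> 0" "v \<noteq> 0" "0 \<le> t" "t \<le> pi" "u \<bullet> v = norm u * norm v * cos t"
  shows "vangle u v = t"
  using assms by (simp add: vangle_def arccos_cos)

lemma sin_vangle:
  assumes "u \<noteq> 0" "v \<noteq> 0" shows "sin (vangle u v) * (norm u * norm v) = \<bar>cross u v\<bar>"
proof -
  have "(sin (vangle u v) * (norm u * norm v))\<^sup>2 = (norm u * norm v)\<^sup>2 - (cos (vangle u v) * (norm u * norm v))\<^sup>2"
    by (simp add: power_mult_distrib sin_squared_eq algebra_simps)
  also have "\<dots> = (cross u v)\<^sup>2"
    unfolding cos_vangle[OF assms] using lagrange_identity[of u v] by simp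
  finally have "\<bar>sin (vangle u v) * (norm u * norm v)\<bar> = \<bar>cross u v\<bar>" by (simp only: power2_eq_iff) auto
  moreover have "sin (vangle u v) \<ge> 0" using vangle_range by (rule sin_ge_zero)
  ultimately show ?thesis by simp
qed

lemma vangle_sym: "vangle u v = vangle v u"
  by (simp add: vangle_def inner_commute mult.commute)

lemma angle_sym: "angle X Y Z = angle Z Y X"
  by (simp add: angle_eq_vangle vangle_sym)

lemma vangle_pos: assumes "cross u v \<noteq> 0" shows "0 < vangle u v" "vangle u v < pi" "sin (vangle u v) > 0"
proof -
  have uv: "u \<noteq> 0" "v \<noteq> 0" using cross_nonzero_imp[OF assms] by auto
  have "\<bar>cross u v\<bar> > 0" using assms by simp
  then show s: "sin (vangle u v) > 0" using sin_vangle[OF uv] uv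
    by (metis mult_pos_pos zero_less_mult_pos2 zero_less_norm_iff)
  show "0 < vangle u v" using s vangle_range(1)[of u v] by (cases "vangle u v = 0") auto
  show "vangle u v < pi" using s vangle_range(2)[of u v] by (cases "vangle u v = pi") auto
qed

lemma vangle_scaleR: "t > 0 \<Longrightarrow> vangle u (t *\<^sub>R v) = vangle u v"
  by (simp add: vangle_def)

lemma vangle_minus: "u \<noteq> 0 \<Longrightarrow> v \<noteq> 0 \<Longrightarrow> vangle u (- v) = pi - vangle u v"
proof -
  assume uv: "u \<noteq> 0" "v \<noteq> 0"
  show ?thesis
  proof (rule vangle_eqI)
    show "u \<bullet> - v = norm u * norm (- v) * cos (pi - vangle u v)"
      using cos_vangle[OF uv] by (simp add: algebra_simps)
  qed (use uv vangle_range in auto)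
qed

lemma vangle_minus_minus: "vangle (- u) (- v) = vangle u v"
  by (simp add: vangle_def)

text \<open>Both turns have the same orientation as the total turn. For complex numbers
\<open>(cnj u v) (cnj v w) = |v|^2 (cnj u w)\<close>, whose real and imaginary parts match the addition formulas; the
sign of the imaginary part shows that the sum stays below pi.\<close>

lemma vangle_add:
  assumes "cross u v * cross v w > 0" "cross u v * cross u w > 0"
  shows "vangle u v + vangle v w = vangle u w"
proof -
  have nz: "cross u v \<noteq> 0" "cross v w \<noteq> 0" "cross u w \<noteq> 0" using assms by auto
  then have uvw: "u \<noteq> 0" "v \<noteq> 0" "w \<noteq> 0" using cross_nonzero_imp by auto
  define \<theta> \<phi> where "\<theta> = vangle u v" and "\<phi> = vangle v w"
  define k where "k = (norm u * norm v) * (norm v * norm w)"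
  have k: "k > 0" using uvw by (simp add: k_def)
  have dots: "(u \<bullet> v) * (v \<bullet> w) - cross u v * cross v w = (norm v)\<^sup>2 * (u \<bullet> w)"
    and crosses: "cross u v * (v \<bullet> w) + (u \<bullet> v) * cross v w = (norm v)\<^sup>2 * cross u w"
    by (simp_all add: power2_norm_eq_inner inner_point cross_def algebra_simps)
  have abs: "\<bar>cross u v\<bar> * \<bar>cross v w\<bar> = cross u v * cross v w"
    using assms(1) by (simp flip: abs_mult)
  have c: "cos (\<theta> + \<phi>) * k = (norm v)\<^sup>2 * (u \<bullet> w)"
    unfolding dots[symmetric] abs[symmetric] cos_vangle[OF uvw(1,2), symmetric] cos_vangle[OF uvw(2,3), symmetric]
      sin_vangle[OF uvw(1,2), symmetric] sin_vangle[OF uvw(2,3), symmetric]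
    by (simp add: cos_add k_def \<theta>_def \<phi>_def algebra_simps)
  have "sin (\<theta> + \<phi>) * k = \<bar>cross u v\<bar> * (v \<bullet> w) + (u \<bullet> v) * \<bar>cross v w\<bar>"
    unfolding cos_vangle[OF uvw(1,2), symmetric] cos_vangle[OF uvw(2,3), symmetric]
      sin_vangle[OF uvw(1,2), symmetric] sin_vangle[OF uvw(2,3), symmetric]
    by (simp add: sin_add k_def \<theta>_def \<phi>_def algebra_simps)
  also have "\<dots> = sgn (cross u v) * (cross u v * (v \<bullet> w) + (u \<bullet> v) * cross v w)"
    using assms(1) by (auto simp: zero_less_mult_iff abs_if sgn_if algebra_simps)
  also have "\<dots> > 0" unfolding crosses using assms(2) uvw
    by (auto simp: zero_less_mult_iff sgn_if mult_pos_neg)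
  finally have s: "sin (\<theta> + \<phi>) > 0" using k by (simp add: zero_less_mult_iff)
  have rng: "0 < \<theta>" "\<theta> < pi" "0 < \<phi>" "\<phi> < pi" unfolding \<theta>_def \<phi>_def using nz vangle_pos by auto
  have "\<theta> + \<phi> < pi"
  proof (rule ccontr)
    assume "\<not> ?thesis"
    then have "0 \<le> sin (\<theta> + \<phi> - pi)" using rng by (intro sin_ge_zero) auto
    then show False using s by (simp add: sin_diff)
  qed
  have "vangle u w = \<theta> + \<phi>"
  proof (rule vangle_eqI)
    have "(norm v)\<^sup>2 * (u \<bullet> w) = (norm v)\<^sup>2 * (norm u * norm w * cos (\<theta> + \<phi>))"
      using c by (auto simp: k_def power2_eq_square mult_ac)
    then show "u \<bullet> w = norm u * norm w * cos (\<theta> + \<phi>)" using uvw by (simp only: mult_cancel_left) auto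
  qed (use uvw rng \<open>\<theta> + \<phi> < pi\<close> in auto)
  then show ?thesis by (simp add: \<theta>_def \<phi>_def)
qed

text \<open>With \<open>e = B - A\<close> and \<open>f = C - A\<close>, turning from \<open>e\<close> to \<open>f\<close> and on to \<open>f - e\<close> adds the angles at
\<open>A\<close> and \<open>C\<close>, and the total turn is the exterior angle at \<open>B\<close>.\<close>

lemma angle_sum_triangle:
  assumes "triangle A B C"
  shows "angle B A C + angle A B C + angle A C B = pi"
proof -
  define e f where "e = B - A" and "f = C - A"
  have K: "cross e f \<noteq> 0" using assms by (simp add: triangle_iff_cross e_def f_def)
  have cr: "cross f (f - e) = cross e f" "cross e (f - e) = cross e f" by (simp_all add: cross_def algebra_simps)
  have nz: "e \<noteq> 0" "f - e \<noteq> 0" using K cr cross_nonzero_imp by metis+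
  have "vangle e f + vangle f (f - e) = vangle e (f - e)"
    by (rule vangle_add) (use K cr in \<open>auto simp: zero_less_mult_iff linorder_neq_iff\<close>)
  moreover have "angle B A C = vangle e f" by (simp add: angle_eq_vangle e_def f_def)
  moreover have "angle A C B = vangle f (f - e)"
    using vangle_minus_minus[of f "f - e"] by (simp add: angle_eq_vangle e_def f_def)
  moreover have "angle A B C = pi - vangle e (f - e)"
    using vangle_minus[OF nz(2,1)] by (simp add: angle_eq_vangle e_def f_def vangle_sym)
  ultimately show ?thesis by simp
qed

lemma triangle_rot: "triangle A B C \<Longrightarrow> triangle B C A"
  by (simp add: triangle_def insert_commute)

lemma triangle_angle_pos: assumes "triangle A B C" shows "0 < angle B A C" "angle B A C < pi"
  using assms vangle_pos unfolding triangle_iff_cross angle_eq_vangle by auto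

section \<open>Interior points and commensurable subdivisions\<close>

definition interior_weights :: "point \<Rightarrow> point \<Rightarrow> point \<Rightarrow> real \<Rightarrow> real \<Rightarrow> real \<Rightarrow> point \<Rightarrow> bool" where
  "interior_weights A B C a b c P \<longleftrightarrow> triangle A B C \<and> 0 < a \<and> 0 < b \<and> 0 < c \<and> a + b + c = 1
     \<and> P = a *\<^sub>R A + b *\<^sub>R B + c *\<^sub>R C"

lemma inside_triangle_iff_weights:
  assumes "triangle A B C"
  shows "inside_triangle A B C P \<longleftrightarrow> (\<exists>a b c. interior_weights A B C a b c P)"
  using interior_convex_hull_3_minimal[of A B C] assms
  unfolding inside_triangle_def interior_weights_def triangle_def by auto

lemma interior_weights_rotate: "interior_weights A B C a b c P \<Longrightarrow> interior_weights B C A b c a P"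
  unfolding interior_weights_def by (auto intro: triangle_rot)

lemma cross_at_vertex:
  assumes "interior_weights A B C a b c P"
  defines "K \<equiv> cross (B - A) (C - A)"
  shows "cross (B - A) (P - A) = c * K" "cross (P - A) (C - A) = b * K" "K \<noteq> 0"
proof -
  have a: "a = 1 - b - c" and P: "P = a *\<^sub>R A + b *\<^sub>R B + c *\<^sub>R C"
    using assms(1) by (auto simp: interior_weights_def)
  have PA: "P - A = b *\<^sub>R (B - A) + c *\<^sub>R (C - A)" unfolding P a by (simp add: algebra_simps)
  show "cross (B - A) (P - A) = c * K" "cross (P - A) (C - A) = b * K"
    unfolding PA by (simp_all add: K_def cross_def algebra_simps)
  show "K \<noteq> 0" using assms by (simp add: interior_weights_def triangle_iff_cross)
qed

text \<open>The last equation holds because the areas of \<open>PAB\<close> and \<open>PAC\<close> are in the ratio \<open>c : b\<close>. Multiplied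
over the three vertices it gives Ceva's theorem.\<close>

lemma interior_angles_at_vertex:
  assumes "interior_weights A B C a b c P"
  shows "angle P A B + angle P A C = angle B A C" "0 < angle P A B" "0 < angle P A C"
    "sin (angle P A B) * (b * dist A B) = sin (angle P A C) * (c * dist A C)"
proof -
  define K where "K = cross (B - A) (C - A)"
  have K: "cross (B - A) (P - A) = c * K" "cross (P - A) (C - A) = b * K" "K \<noteq> 0"
    using cross_at_vertex[OF assms] by (simp_all add: K_def)
  have bc: "b > 0" "c > 0" using assms by (auto simp: interior_weights_def)
  have nz: "cross (B - A) (P - A) \<noteq> 0" "cross (P - A) (C - A) \<noteq> 0" using K bc by auto
  have v: "angle P A B = vangle (B - A) (P - A)" "angle P A C = vangle (P - A) (C - A)"
    "angle B A C = vangle (B - A) (C - A)" by (simp_all add: angle_eq_vangle vangle_sym)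
  have "K * K > 0" using K(3) not_real_square_gt_zero by blast
  then have "(c * b) * (K * K) > 0" "c * (K * K) > 0" using bc by simp_all
  then show "angle P A B + angle P A C = angle B A C" unfolding v
    by (intro vangle_add) (simp_all add: K(1,2) mult_ac flip: K_def)
  show "0 < angle P A B" "0 < angle P A C" unfolding v using vangle_pos(1) nz by auto
  have n: "B - A \<noteq> 0" "P - A \<noteq> 0" "C - A \<noteq> 0" using nz cross_nonzero_imp by metis+
  have "sin (angle P A B) * (norm (B - A) * norm (P - A)) = c * \<bar>K\<bar>"
    "sin (angle P A C) * (norm (P - A) * norm (C - A)) = b * \<bar>K\<bar>"
    unfolding v using sin_vangle[OF n(1,2)] sin_vangle[OF n(2,3)] K bc by (auto simp: abs_mult)
  then have "norm (P - A) * (sin (angle P A B) * (b * norm (B - A))) = norm (P - A) * (sin (angle P A C) * (c * norm (C - A)))"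
    by (simp add: algebra_simps)
  then show "sin (angle P A B) * (b * dist A B) = sin (angle P A C) * (c * dist A C)"
    using n by (simp add: dist_norm norm_minus_commute)
qed

lemma triangle_dist_pos: assumes "triangle A B C" shows "dist A B > 0" "dist B C > 0" "dist C A > 0"
  using assms unfolding triangle_def by (auto simp: insert_commute)

lemma interior_angles:
  assumes "interior_weights A B C a b c P"
  shows "angle P A B + angle P A C = angle B A C" "angle P B C + angle P B A = angle A B C" "angle P C A + angle P C B = angle A C B"
    "0 < angle P A B" "0 < angle P A C" "0 < angle P B C" "0 < angle P B A" "0 < angle P C A" "0 < angle P C B"
    "angle B A C + angle A B C + angle A C B = pi"
proof -
  note B = interior_weights_rotate[OF assms]
  note C = interior_weights_rotate[OF B]
  show "angle P A B + angle P A C = angle B A C" "angle P B C + angle P B A = angle A B C" "angle P C A + angle P C B = angle A C B"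
    "0 < angle P A B" "0 < angle P A C" "0 < angle P B C" "0 < angle P B A" "0 < angle P C A" "0 < angle P C B"
    using interior_angles_at_vertex(1-3)[OF assms] interior_angles_at_vertex(1-3)[OF B] interior_angles_at_vertex(1-3)[OF C]
    by (simp_all add: angle_sym)
  show "angle B A C + angle A B C + angle A C B = pi"
    using assms angle_sum_triangle by (simp add: interior_weights_def)
qed

lemma trig_ceva:
  assumes "interior_weights A B C a b c P"
  shows "sin (angle P A B) * sin (angle P B C) * sin (angle P C A) = sin (angle P A C) * sin (angle P B A) * sin (angle P C B)"
proof -
  note B = interior_weights_rotate[OF assms]
  note C = interior_weights_rotate[OF B]
  have tri: "triangle A B C" and pos: "a > 0" "b > 0" "c > 0" using assms by (auto simp: interior_weights_def)
  define k where "k = a * b * c * dist A B * dist B C * dist C A"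
  have "k > 0" using pos triangle_dist_pos[OF tri] by (simp add: k_def)
  have "(sin (angle P A B) * sin (angle P B C) * sin (angle P C A)) * k
      = (sin (angle P A B) * (b * dist A B)) * (sin (angle P B C) * (c * dist B C)) * (sin (angle P C A) * (a * dist C A))"
    by (simp add: k_def mult_ac)
  also have "\<dots> = (sin (angle P A C) * (c * dist A C)) * (sin (angle P B A) * (a * dist B A)) * (sin (angle P C B) * (b * dist C B))"
    unfolding interior_angles_at_vertex(4)[OF assms] interior_angles_at_vertex(4)[OF B] interior_angles_at_vertex(4)[OF C] ..
  also have "\<dots> = (sin (angle P A C) * sin (angle P B A) * sin (angle P C B)) * k"
    by (simp add: k_def mult_ac dist_commute)
  finally show ?thesis using \<open>k > 0\<close> by simp
qed

lemma weight_ratio_from_angle: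
  assumes P: "interior_weights A B C a b c P" and Q: "interior_weights A B C a' b' c' Q"
    and eq: "angle P A B = angle Q A B"
  shows "b * c' = b' * c"
proof -
  have tri: "triangle A B C" and pos: "b > 0" "c > 0" "b' > 0" "c' > 0" using P Q by (auto simp: interior_weights_def)
  have eq': "angle P A C = angle Q A C"
    using eq interior_angles_at_vertex(1)[OF P] interior_angles_at_vertex(1)[OF Q] by simp
  have "angle P A B < pi" "angle P A C < pi"
    using interior_angles_at_vertex(1-3)[OF P] triangle_angle_pos(2)[OF tri] by linarith+
  then have s: "sin (angle P A B) > 0" "sin (angle P A C) > 0"
    using interior_angles_at_vertex(2,3)[OF P] by (auto intro: sin_gt_zero)
  define S T where "S = sin (angle P A B) * dist A B" and "T = sin (angle P A C) * dist A C"
  have "S > 0" "T > 0" using s triangle_dist_pos[OF tri] by (auto simp: S_def T_def dist_commute)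
  have "S * b = T * c" "S * b' = T * c'"
    using interior_angles_at_vertex(4)[OF P] interior_angles_at_vertex(4)[OF Q]
    by (simp_all add: S_def T_def eq eq' mult_ac)
  then have "(S * b) * (T * c') = (S * b') * (T * c)" by simp
  then have "(S * T) * (b * c') = (S * T) * (b' * c)" by (simp add: mult_ac)
  then show ?thesis using \<open>S > 0\<close> \<open>T > 0\<close> by simp
qed

text \<open>The way \<open>P\<close> splits the angle at \<open>A\<close> fixes the ratio of the weights of \<open>B\<close> and \<open>C\<close>; two
such ratios fix all weights.\<close>

lemma interior_point_determined_by_two_angles:
  assumes "triangle A B C" "inside_triangle A B C P" "inside_triangle A B C Q"
    and "angle P A B = angle Q A B" "angle P B C = angle Q B C"
  shows "P = Q"
proof -
  obtain a b c where P: "interior_weights A B C a b c P" using assms inside_triangle_iff_weights by blast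
  obtain a' b' c' where Q: "interior_weights A B C a' b' c' Q" using assms inside_triangle_iff_weights by blast
  have 1: "b * c' = b' * c" using weight_ratio_from_angle[OF P Q assms(4)] .
  have 2: "c * a' = c' * a" using weight_ratio_from_angle[OF interior_weights_rotate[OF P] interior_weights_rotate[OF Q] assms(5)] .
  have w: "c > 0" "c' > 0" "a + b + c = 1" "a' + b' + c' = 1" using P Q by (auto simp: interior_weights_def)
  have "c' * (a + b + c) = c * (a' + b' + c')" using 1 2 by (simp add: algebra_simps)
  then have "c' = c" using w by simp
  then have "a' = a" "b' = b" using 1 2 w by auto
  then show ?thesis using P Q \<open>c' = c\<close> by (simp add: interior_weights_def)
qed

lemma rational_multiple_add: "rational_multiple_of_pi x \<Longrightarrow> rational_multiple_of_pi y \<Longrightarrow> rational_multiple_of_pi (x + y)"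
  unfolding rational_multiple_of_pi_def by (metis Rats_add distrib_right)

lemma rational_multiple_diff: "rational_multiple_of_pi x \<Longrightarrow> rational_multiple_of_pi y \<Longrightarrow> rational_multiple_of_pi (x - y)"
  unfolding rational_multiple_of_pi_def by (metis Rats_diff left_diff_distrib)

lemma rational_multiple_half: "rational_multiple_of_pi x \<Longrightarrow> rational_multiple_of_pi (x / 2)"
  unfolding rational_multiple_of_pi_def by (metis Rats_divide Rats_number_of times_divide_eq_left)

lemma rational_multiple_pi: "rational_multiple_of_pi pi"
  unfolding rational_multiple_of_pi_def by (rule bexI[of _ 1]) auto

lemma pi_commensurable_if_two_angles:
  assumes "triangle X Y Z" "rational_multiple_of_pi (angle Y X Z)" "rational_multiple_of_pi (angle X Y Z)"
  shows "pi_commensurable X Y Z"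
proof -
  have "angle X Z Y = pi - (angle Y X Z + angle X Y Z)" using angle_sum_triangle[OF assms(1)] by simp
  then have "rational_multiple_of_pi (angle X Z Y)"
    using assms by (auto intro: rational_multiple_diff rational_multiple_add rational_multiple_pi)
  then show ?thesis using assms unfolding pi_commensurable_def by blast
qed

definition six_angles_rational :: "point \<Rightarrow> point \<Rightarrow> point \<Rightarrow> point \<Rightarrow> bool" where
  "six_angles_rational A B C P \<longleftrightarrow>
     rational_multiple_of_pi (angle P A B) \<and> rational_multiple_of_pi (angle P A C) \<and>
     rational_multiple_of_pi (angle P B C) \<and> rational_multiple_of_pi (angle P B A) \<and>
     rational_multiple_of_pi (angle P C A) \<and> rational_multiple_of_pi (angle P C B)"

lemma angle_point_on_side:
  assumes "F \<in> closed_segment A B" "F \<noteq> A"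
  shows "angle P A F = angle P A B"
proof -
  obtain t where t: "0 \<le> t" "F = (1 - t) *\<^sub>R A + t *\<^sub>R B" using assms(1) by (auto simp: closed_segment_def)
  then have "F - A = t *\<^sub>R (B - A)" by (simp add: algebra_simps)
  moreover have "t > 0" using t assms(2) by (cases "t = 0") auto
  ultimately show ?thesis using vangle_scaleR[of t "P - A" "B - A"] by (simp add: angle_eq_vangle)
qed

lemma triangle_distinct: "triangle X Y Z \<Longrightarrow> X \<noteq> Y \<and> Y \<noteq> Z \<and> X \<noteq> Z"
  unfolding triangle_def by (auto simp: insert_commute)

text \<open>An angle of a subtriangle at a vertex of the large triangle does not change when the foot \<open>F\<close> is replaced by the
other end of the side.\<close>

lemma rational_from_subtriangles:
  assumes F: "F \<in> closed_segment A B" and "pi_commensurable P A F" "pi_commensurable P F B"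
  shows "rational_multiple_of_pi (angle P A B)" "rational_multiple_of_pi (angle P B A)"
proof -
  have "F \<noteq> A" "F \<noteq> B" using assms triangle_distinct unfolding pi_commensurable_def by blast+
  then have "angle P A F = angle P A B" "angle P B F = angle P B A"
    using F angle_point_on_side closed_segment_commute by metis+
  then show "rational_multiple_of_pi (angle P A B)" "rational_multiple_of_pi (angle P B A)"
    using assms(2,3) unfolding pi_commensurable_def by auto
qed

text \<open>The foot \<open>F\<close> lies on the ray from \<open>P\<close> opposite to \<open>C\<close>, so the angles at \<open>P\<close> of the two
subtriangles are exterior angles of \<open>APC\<close> and \<open>BPC\<close>, hence each is a sum of two of the six angles.\<close>

lemma cevian_foot_commensurable:
  assumes w: "interior_weights A B C a b c P" and rat: "six_angles_rational A B C P"
  shows "\<exists>F. F \<in> affine hull {C, P} \<inter> closed_segment A B \<and> pi_commensurable P A F \<and> pi_commensurable P F B"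
proof -
  have tri: "triangle A B C" and pos: "a > 0" "b > 0" "c > 0" and sum: "a + b + c = 1"
    and P: "P = a *\<^sub>R A + b *\<^sub>R B + c *\<^sub>R C" using w by (auto simp: interior_weights_def)
  \<comment> \<open>Position of the foot on \<open>AB\<close>: drop the weight of \<open>C\<close> and normalise.\<close>
  define t where "t = b / (a + b)"
  define F where "F = (1 - t) *\<^sub>R A + t *\<^sub>R B"
  have t: "0 < t" "t < 1" using pos by (auto simp: t_def divide_simps)
  have tab: "(1 - t) * (a + b) = a" "t * (a + b) = b" using pos by (auto simp: t_def field_simps)
  have PF: "P = (a + b) *\<^sub>R F + c *\<^sub>R C"
  proof -
    have "(a + b) *\<^sub>R F = a *\<^sub>R A + b *\<^sub>R B"
      unfolding F_def scaleR_add_right scaleR_scaleR using tab by (simp only: mult.commute[of "a + b"])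
    then show ?thesis using P by simp
  qed
  have ab: "a + b > 0" "a + b = 1 - c" using pos sum by auto
  have F_seg: "F \<in> closed_segment A B" unfolding closed_segment_def F_def using t by auto
  have FC: "F = (- c / (a + b)) *\<^sub>R C + (1 / (a + b)) *\<^sub>R P"
    unfolding PF scaleR_add_right scaleR_scaleR using ab(1) by (simp flip: scaleR_left.add)
  have "- c / (a + b) + 1 / (a + b) = 1" using ab by (simp add: field_simps)
  then have F_aff: "F \<in> affine hull {C, P}" unfolding affine_hull_2 using FC by blast
  define k where "k = c / (a + b)"
  have k: "k > 0" using pos by (simp add: k_def)
  have FP: "F - P = k *\<^sub>R (P - C)"
  proof -
    have "(a + b) *\<^sub>R (F - P) = (a + b) *\<^sub>R F - P + c *\<^sub>R P" unfolding ab(2) by (simp add: algebra_simps)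
    also have "\<dots> = c *\<^sub>R (P - C)" unfolding PF by (simp add: algebra_simps)
    also have "\<dots> = (a + b) *\<^sub>R (k *\<^sub>R (P - C))" using ab(1) by (simp add: k_def)
    finally show ?thesis using ab(1) by (simp only: scaleR_cancel_left) auto
  qed
  have FP': "F - P = - (k *\<^sub>R (C - P))" using FP by (simp add: algebra_simps)
  have angle_F: "angle X P F = pi - angle X P C" if "triangle X P C" for X
  proof -
    have "X - P \<noteq> 0" "C - P \<noteq> 0" using triangle_distinct[OF that] by auto
    then show ?thesis using vangle_minus[of "X - P" "k *\<^sub>R (C - P)"] vangle_scaleR[OF k, of "X - P" "C - P"] k
      unfolding angle_eq_vangle FP' by auto
  qed
  note wB = interior_weights_rotate[OF w]
  have crA: "cross (P - A) (C - A) \<noteq> 0" "cross (B - A) (P - A) \<noteq> 0" using cross_at_vertex[OF w] pos by auto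
  have crB: "cross (C - B) (P - B) \<noteq> 0" using cross_at_vertex[OF wB] pos by auto
  have tri_APC: "triangle A P C" using crA(1) by (simp add: triangle_iff_cross)
  have tri_BPC: "triangle B P C" using crB by (simp add: triangle_iff_cross cross_def algebra_simps)
  have "cross (A - P) (F - P) = t * cross (B - A) (P - A)"
    by (simp add: F_def cross_def algebra_simps)
  then have tri_PAF: "triangle P A F" using crA(2) t by (simp add: triangle_iff_cross)
  have "cross (F - P) (B - P) = (1 - t) * cross (B - A) (P - A)"
    by (simp add: F_def cross_def algebra_simps)
  then have tri_PFB: "triangle P F B" using crA(2) t by (simp add: triangle_iff_cross)
  have sumA: "angle P A C + angle A P C + angle A C P = pi" using angle_sum_triangle[OF tri_APC] .
  have sumB: "angle P B C + angle B P C + angle B C P = pi" using angle_sum_triangle[OF tri_BPC] .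
  have F_ne: "F \<noteq> A" "F \<noteq> B" using triangle_distinct tri_PAF tri_PFB by blast+
  have on: "angle P A F = angle P A B" "angle P B F = angle P B A"
    using F_seg F_ne angle_point_on_side closed_segment_commute by metis+
  have r: "rational_multiple_of_pi (angle P A B)" "rational_multiple_of_pi (angle P A C)"
     "rational_multiple_of_pi (angle P B C)" "rational_multiple_of_pi (angle P B A)"
     "rational_multiple_of_pi (angle A C P)" "rational_multiple_of_pi (angle B C P)"
    using rat by (auto simp: six_angles_rational_def angle_sym[of _ C P])
  have "angle A P F = angle P A C + angle A C P" using angle_F[OF tri_APC] sumA by simp
  then have "rational_multiple_of_pi (angle A P F)" using r by (auto intro: rational_multiple_add)
  then have 1: "pi_commensurable P A F" by (intro pi_commensurable_if_two_angles tri_PAF) (use r on in auto)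
  have BPF: "angle F P B = angle P B C + angle B C P" using angle_F[OF tri_BPC] sumB by (simp add: angle_sym[of F])
  then have "rational_multiple_of_pi (angle F P B)" using r by (auto intro: rational_multiple_add)
  moreover have "angle P F B = pi - (angle F P B + angle P B A)" using angle_sum_triangle[OF tri_PFB] on by simp
  then have "rational_multiple_of_pi (angle P F B)" using r calculation by (auto intro: rational_multiple_add rational_multiple_diff rational_multiple_pi)
  ultimately have 2: "pi_commensurable P F B" by (intro pi_commensurable_if_two_angles tri_PFB)
  show ?thesis using F_aff F_seg 1 2 by blast
qed

lemma pi_commensurable_subdivision_iff:
  assumes "triangle A B C"
  shows "pi_commensurable_subdivision A B C P \<longleftrightarrow> inside_triangle A B C P \<and> six_angles_rational A B C P"
proof
  assume "pi_commensurable_subdivision A B C P"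
  then obtain D E F where *: "inside_triangle A B C P" "D \<in> closed_segment B C" "E \<in> closed_segment C A" "F \<in> closed_segment A B"
    "pi_commensurable P A F" "pi_commensurable P F B" "pi_commensurable P B D" "pi_commensurable P D C"
    "pi_commensurable P C E" "pi_commensurable P E A" unfolding pi_commensurable_subdivision_def by blast
  show "inside_triangle A B C P \<and> six_angles_rational A B C P"
    unfolding six_angles_rational_def
    using *(1) rational_from_subtriangles[OF *(4-6)] rational_from_subtriangles[OF *(2,7,8)] rational_from_subtriangles[OF *(3,9,10)]
    by blast
next
  assume *: "inside_triangle A B C P \<and> six_angles_rational A B C P"
  then obtain a b c where w: "interior_weights A B C a b c P" using inside_triangle_iff_weights[OF assms] by blast
  note wB = interior_weights_rotate[OF w]
  note wC = interior_weights_rotate[OF wB]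
  have r: "six_angles_rational B C A P" "six_angles_rational C A B P" using * by (auto simp: six_angles_rational_def)
  show "pi_commensurable_subdivision A B C P"
    unfolding pi_commensurable_subdivision_def
    using * cevian_foot_commensurable[OF w] cevian_foot_commensurable[OF wB r(1)] cevian_foot_commensurable[OF wC r(2)]
    by blast
qed

section \<open>From points to the sine equation\<close>

text \<open>Each triple product of sines is a signed sum of four sines. The angle sum pi turns these into cosines; the cosine of
\<open>u + v + w\<close> appears on both sides and cancels, and the remaining ones pair up into products of two sines.\<close>

lemma trig_ceva_sum_form:
  fixes x x' y y' z z' :: real
  assumes "x + x' + (y + y') + (z + z') = pi"
    "sin x * sin y * sin z = sin x' * sin y' * sin z'"
  defines "u \<equiv> (x - x') / 2" and "v \<equiv> (y - y') / 2" and "w \<equiv> (z - z') / 2"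
  shows "sin (x + x') * sin (- u + v + w) + sin (y + y') * sin (u - v + w) + sin (z + z') * sin (u + v - w) = 0"
proof -
  have triple: "4 * (sin a * sin b * sin c) = sin (a + b - c) + sin (a - b + c) + sin (- a + b + c) - sin (a + b + c)"
    for a b c :: real
  proof -
    have "sin (a + b - c) = sin (a + b) * cos c - cos (a + b) * sin c" by (rule sin_diff)
    moreover have "sin (a - b + c) = sin (a - b) * cos c + cos (a - b) * sin c" by (rule sin_add)
    moreover have "sin (- a + b + c) = - sin (a - b) * cos c + cos (a - b) * sin c"
      using sin_add[of "- (a - b)" c] by (simp only: sin_minus cos_minus) (simp add: algebra_simps)
    moreover have "sin (a + b + c) = sin (a + b) * cos c + cos (a + b) * sin c" by (rule sin_add)
    ultimately show ?thesis by (simp add: cos_add cos_diff algebra_simps)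
  qed
  have prod: "2 * (sin s * sin t) = cos (s - t) - cos (s + t)" for s t :: real by (simp add: cos_diff cos_add)
  have sin_cos: "sin (pi / 2 - t) = cos t" for t :: real by (simp add: sin_diff)
  have eqs: "x + y - z = pi / 2 - (z + z' - (u + v - w))" "x - y + z = pi / 2 - (y + y' - (u - v + w))"
    "- x + y + z = pi / 2 - (x + x' - (- u + v + w))" "x + y + z = pi / 2 - - (u + v + w)"
    "x' + y' - z' = pi / 2 - (z + z' + (u + v - w))" "x' - y' + z' = pi / 2 - (y + y' + (u - v + w))"
    "- x' + y' + z' = pi / 2 - (x + x' + (- u + v + w))" "x' + y' + z' = pi / 2 - (u + v + w)"
    unfolding u_def v_def w_def using assms(1) by (simp_all add: field_simps)
  have "4 * (sin x * sin y * sin z) = cos (z + z' - (u + v - w)) + cos (y + y' - (u - v + w)) + cos (x + x' - (- u + v + w)) - cos (u + v + w)"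
    unfolding triple eqs sin_cos cos_minus ..
  moreover have "4 * (sin x' * sin y' * sin z') = cos (z + z' + (u + v - w)) + cos (y + y' + (u - v + w)) + cos (x + x' + (- u + v + w)) - cos (u + v + w)"
    unfolding triple eqs sin_cos ..
  ultimately show ?thesis
    using assms(2) prod[of "x + x'" "- u + v + w"] prod[of "y + y'" "u - v + w"] prod[of "z + z'" "u + v - w"]
    by linarith
qed

text \<open>The signed angle between \<open>YP\<close> and the bisector at \<open>Y\<close>; at the three vertices this is \<open>u, v, w\<close>.\<close>

definition bisector_offset :: "point \<Rightarrow> point \<Rightarrow> point \<Rightarrow> point \<Rightarrow> real" where
  "bisector_offset X Y Z P = (angle P Y X - angle P Y Z) / 2"

lemma subdivision_offsets:
  assumes "pi_commensurable A B C" "pi_commensurable_subdivision A B C P"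
  defines "u \<equiv> bisector_offset B A C P" and "v \<equiv> bisector_offset C B A P" and "w \<equiv> bisector_offset A C B P"
  shows "sin (angle B A C) * sin (- u + v + w) + sin (angle A B C) * sin (u - v + w) + sin (angle A C B) * sin (u + v - w) = 0"
    and "\<bar>2 * u\<bar> < angle B A C" "\<bar>2 * v\<bar> < angle A B C" "\<bar>2 * w\<bar> < angle A C B"
    and "rational_multiple_of_pi (- u + v + w)" "rational_multiple_of_pi (u - v + w)" "rational_multiple_of_pi (u + v - w)"
proof -
  have tri: "triangle A B C" using assms(1) by (simp add: pi_commensurable_def)
  have P: "inside_triangle A B C P" "six_angles_rational A B C P"
    using assms(2) pi_commensurable_subdivision_iff[OF tri] by auto
  obtain a b c where wt: "interior_weights A B C a b c P" using P(1) inside_triangle_iff_weights[OF tri] by blast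
  note ang = interior_angles[OF wt]
  have "angle P A B + angle P A C + (angle P B C + angle P B A) + (angle P C A + angle P C B) = pi"
    unfolding ang(1-3) by (rule ang(10))
  from trig_ceva_sum_form[OF this trig_ceva[OF wt]]
  show "sin (angle B A C) * sin (- u + v + w) + sin (angle A B C) * sin (u - v + w) + sin (angle A C B) * sin (u + v - w) = 0"
    unfolding ang(1-3) u_def v_def w_def bisector_offset_def .
  show "\<bar>2 * u\<bar> < angle B A C" "\<bar>2 * v\<bar> < angle A B C" "\<bar>2 * w\<bar> < angle A C B"
    unfolding u_def v_def w_def bisector_offset_def ang(1-3)[symmetric] using ang(4-9) by auto
  have "rational_multiple_of_pi u" "rational_multiple_of_pi v" "rational_multiple_of_pi w"
    unfolding u_def v_def w_def bisector_offset_def using P(2)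
    by (auto simp: six_angles_rational_def intro!: rational_multiple_half rational_multiple_diff)
  then have "rational_multiple_of_pi (v + w - u)" "rational_multiple_of_pi (u - v + w)" "rational_multiple_of_pi (u + v - w)"
    by (auto intro!: rational_multiple_add rational_multiple_diff)
  then show "rational_multiple_of_pi (- u + v + w)" "rational_multiple_of_pi (u - v + w)" "rational_multiple_of_pi (u + v - w)"
    by (simp_all add: algebra_simps)
qed

text \<open>With weights proportional to the opposite sides, the areas of \<open>PAB\<close> and \<open>PAC\<close> are in the ratio of
the sides \<open>AB\<close> and \<open>AC\<close>, so the two angles at \<open>A\<close> have equal sines and, their sum being
less than pi, are equal.\<close>

lemma incenter_exists_unique:
  assumes tri: "triangle A B C"
  shows "\<exists>!P. is_incenter A B C P"
proof -
  have d: "dist A B > 0" "dist B C > 0" "dist C A > 0" using triangle_dist_pos[OF tri] .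
  define S where "S = dist A B + dist B C + dist C A"
  have S: "S > 0" unfolding S_def using d by (intro add_pos_pos)
  define a b c where "a = dist B C / S" and "b = dist C A / S" and "c = dist A B / S"
  define I where "I = a *\<^sub>R A + b *\<^sub>R B + c *\<^sub>R C"
  have "a + b + c = S / S" unfolding a_def b_def c_def by (simp add: S_def flip: add_divide_distrib)
  then have wt: "interior_weights A B C a b c I"
    unfolding interior_weights_def using tri d S by (auto simp: a_def b_def c_def I_def)
  have bisect: "angle X Q Y = angle X Q Z"
    if w: "interior_weights Q Y Z a b c X" and e: "b * dist Q Y = c * dist Q Z" for Q Y Z X a b c
  proof -
    note v = interior_angles_at_vertex[OF w]
    have "triangle Q Y Z" "b > 0" using w by (auto simp: interior_weights_def)
    then have "b * dist Q Y > 0" "angle Y Q Z < pi" using triangle_dist_pos[of Q Y Z] triangle_angle_pos[of Q Y Z] by auto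
    then have "sin (angle X Q Y) = sin (angle X Q Z)" using v(4) e by auto
    then show ?thesis using sin_inj_triangle[of "angle X Q Y" "angle X Q Z"] v(1-3) \<open>angle Y Q Z < pi\<close> by simp
  qed
  note wB = interior_weights_rotate[OF wt]
  note wC = interior_weights_rotate[OF wB]
  have ex: "is_incenter A B C I" unfolding is_incenter_def
    using bisect[OF wt] bisect[OF wB] bisect[OF wC] wt inside_triangle_iff_weights[OF tri]
    by (auto simp: a_def b_def c_def dist_commute)
  have half: "angle P A B = angle B A C / 2 \<and> angle P B C = angle A B C / 2" if "is_incenter A B C P" for P
  proof -
    obtain a b c where "interior_weights A B C a b c P"
      using \<open>is_incenter A B C P\<close> inside_triangle_iff_weights[OF tri] by (auto simp: is_incenter_def)
    from interior_angles[OF this] show ?thesis using that by (simp add: is_incenter_def)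
  qed
  show ?thesis
  proof (rule ex1I)
    show "is_incenter A B C I" by (rule ex)
    fix P assume P: "is_incenter A B C P"
    show "P = I"
      by (rule interior_point_determined_by_two_angles[OF tri])
         (use P ex half[OF P] half[OF ex] in \<open>auto simp: is_incenter_def\<close>)
  qed
qed

lemma incenter_commensurable:
  assumes "pi_commensurable A B C" "is_incenter A B C P"
  shows "pi_commensurable_subdivision A B C P"
proof -
  have tri: "triangle A B C" and rat: "rational_multiple_of_pi (angle B A C)" "rational_multiple_of_pi (angle A B C)"
    "rational_multiple_of_pi (angle A C B)" using assms(1) by (auto simp: pi_commensurable_def)
  have ins: "inside_triangle A B C P" using assms(2) by (simp add: is_incenter_def)
  then obtain a b c where "interior_weights A B C a b c P" using inside_triangle_iff_weights[OF tri] by auto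
  from interior_angles(1-3)[OF this] have
    "angle P A B = angle B A C / 2" "angle P A C = angle B A C / 2" "angle P B C = angle A B C / 2"
    "angle P B A = angle A B C / 2" "angle P C A = angle A C B / 2" "angle P C B = angle A C B / 2"
    using assms(2) by (auto simp: is_incenter_def)
  then have "six_angles_rational A B C P"
    unfolding six_angles_rational_def using rat[THEN rational_multiple_half] by (simp only: simp_thms)
  then show ?thesis using ins pi_commensurable_subdivision_iff[OF tri] by blast
qed

lemma equal_angles_imp_equal_sides:
  assumes "triangle A B C" "angle B A C = angle A B C"
  shows "dist C A = dist C B"
proof -
  have nz: "B - A \<noteq> 0" "C - A \<noteq> 0" "C - B \<noteq> 0" "A - B \<noteq> 0" using triangle_distinct[OF assms(1)] by auto
  have "sin (angle B A C) * (norm (B - A) * norm (C - A)) = \<bar>cross (B - A) (C - A)\<bar>"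
    unfolding angle_eq_vangle by (rule sin_vangle[OF nz(1,2)])
  also have "\<dots> = \<bar>cross (A - B) (C - B)\<bar>" by (simp add: cross_def algebra_simps)
  also have "\<dots> = sin (angle B A C) * (norm (B - A) * norm (C - B))"
    unfolding assms(2) unfolding angle_eq_vangle norm_minus_commute[of B A] by (rule sin_vangle[OF nz(4,3), symmetric])
  finally have "sin (angle B A C) * norm (B - A) * norm (C - A) = sin (angle B A C) * norm (B - A) * norm (C - B)" by simp
  moreover have "sin (angle B A C) > 0" using triangle_angle_pos[OF assms(1)] by (intro sin_gt_zero)
  ultimately show ?thesis using nz by (simp add: dist_norm)
qed

lemma not_isosceles_distinct_angles:
  assumes tri: "triangle A B C" and "\<not> isosceles A B C"
  shows "angle B A C \<noteq> angle A B C" "angle B A C \<noteq> angle A C B" "angle A B C \<noteq> angle A C B"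
proof -
  have "triangle A C B" "triangle B C A" using tri by (auto simp: triangle_def insert_commute)
  then show "angle B A C \<noteq> angle A B C" "angle B A C \<noteq> angle A C B" "angle A B C \<noteq> angle A C B"
    using equal_angles_imp_equal_sides[of A B C] equal_angles_imp_equal_sides[of A C B] equal_angles_imp_equal_sides[of B C A]
      assms unfolding isosceles_def by (auto simp: angle_sym dist_commute)
qed

section \<open>Finiteness for scalene triangles\<close>

text \<open>The triple \<open>(p, q, r)\<close> determines \<open>P\<close> and lies in a finite grid.\<close>

theorem finitely_many_subdivisions:
  assumes pc: "pi_commensurable A B C" and "\<not> isosceles A B C"
  shows "finite {P. pi_commensurable_subdivision A B C P}"
proof -
  define \<alpha> \<beta> \<gamma> where "\<alpha> = angle B A C" and "\<beta> = angle A B C" and "\<gamma> = angle A C B"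
  have tri: "triangle A B C" and rat: "rational_multiple_of_pi \<alpha>" "rational_multiple_of_pi \<beta>" "rational_multiple_of_pi \<gamma>"
    using pc by (auto simp: pi_commensurable_def \<alpha>_def \<beta>_def \<gamma>_def)
  have sum: "\<alpha> + \<beta> + \<gamma> = pi" using angle_sum_triangle[OF tri] by (simp add: \<alpha>_def \<beta>_def \<gamma>_def)
  have "triangle B C A" "triangle C A B" using tri triangle_rot by blast+
  then have pos: "\<alpha> > 0" "\<beta> > 0" "\<gamma> > 0" using tri triangle_angle_pos(1) angle_sym unfolding \<alpha>_def \<beta>_def \<gamma>_def by metis+
  have ne: "\<alpha> \<noteq> \<beta>" "\<alpha> \<noteq> \<gamma>" "\<beta> \<noteq> \<gamma>" using not_isosceles_distinct_angles[OF tri assms(2)] by (auto simp: \<alpha>_def \<beta>_def \<gamma>_def)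
  obtain M1 M2 M3 where M: "M1 > 0" "M2 > 0" "M3 > 0" "cis \<alpha> ^ M1 = 1" "cis \<beta> ^ M2 = 1" "cis \<gamma> ^ M3 = 1"
    using rat[THEN rational_multiple_of_pi_root_of_unity] by blast
  \<comment> \<open>30 is the product of the primes up to 6, the number of exponentials in the sine equation.\<close>
  define N where "N = 30 * M1 * M2 * M3"
  have N: "N > 0" "30 dvd N" using M by (auto simp: N_def)
  have pow: "z ^ m = 1 \<Longrightarrow> m dvd n \<Longrightarrow> z ^ n = 1" for z :: complex and m n by (auto simp: power_mult)
  have cisN: "cis \<alpha> ^ N = 1" "cis \<beta> ^ N = 1" "cis \<gamma> ^ N = 1"
    using M(4-6)[THEN pow] by (auto simp: N_def)
  define G where "G = (\<lambda>T::int. of_int T * pi / of_nat N) ` {- int N..int N}"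
  have G: "t \<in> G" if "t = of_int T * pi / of_nat N" "\<bar>t\<bar> < pi / 2" for t and T :: int
  proof -
    have "\<bar>of_int T\<bar> * pi = \<bar>t\<bar> * of_nat N" using that(1) N(1) by (simp add: abs_mult)
    also have "\<dots> \<le> pi * of_nat N" using that(2) by (intro mult_right_mono) auto
    finally have "\<bar>of_int T\<bar> \<le> (of_nat N :: real)" by simp
    then have "T \<in> {- int N..int N}" by (simp add: abs_le_iff)
    then show ?thesis unfolding G_def that(1) by blast
  qed
  define f where "f P = (let u = bisector_offset B A C P; v = bisector_offset C B A P; w = bisector_offset A C B P
      in (- u + v + w, u - v + w, u + v - w))" for P
  have "f P \<in> G \<times> G \<times> G" if "pi_commensurable_subdivision A B C P" for P
  proof -
    define u v w where "u = bisector_offset B A C P" and "v = bisector_offset C B A P" and "w = bisector_offset A C B P"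
    note off = subdivision_offsets[OF pc that, folded u_def v_def w_def \<alpha>_def \<beta>_def \<gamma>_def]
    have lt: "\<bar>(u - v + w) + (u + v - w)\<bar> < \<alpha>" "\<bar>(- u + v + w) + (u + v - w)\<bar> < \<beta>" "\<bar>(- u + v + w) + (u - v + w)\<bar> < \<gamma>"
      using off(2-4) by simp_all
    obtain P' Q' R' :: int where PQR: "- u + v + w = of_int P' * pi / of_nat N" "u - v + w = of_int Q' * pi / of_nat N"
      "u + v - w = of_int R' * pi / of_nat N"
      by (rule rational_solutions_have_bounded_denominator[OF sum pos ne lt N cisN off(5-7,1)])
    have "\<bar>- u + v + w\<bar> < pi / 2" "\<bar>u - v + w\<bar> < pi / 2" "\<bar>u + v - w\<bar> < pi / 2" using off(2-4) sum by linarith+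
    then have "- u + v + w \<in> G" "u - v + w \<in> G" "u + v - w \<in> G" using G PQR by blast+
    then show ?thesis unfolding f_def Let_def u_def v_def w_def by simp
  qed
  then have "f ` {P. pi_commensurable_subdivision A B C P} \<subseteq> G \<times> G \<times> G" by blast
  moreover have "inj_on f {P. pi_commensurable_subdivision A B C P}"
  proof (rule inj_onI)
    fix P Q assume "P \<in> {P. pi_commensurable_subdivision A B C P}" "Q \<in> {P. pi_commensurable_subdivision A B C P}" and eq: "f P = f Q"
    then have ins: "inside_triangle A B C P" "inside_triangle A B C Q" by (auto simp: pi_commensurable_subdivision_def)
    obtain a b c where P: "interior_weights A B C a b c P" using ins inside_triangle_iff_weights[OF tri] by blast
    obtain a' b' c' where Q: "interior_weights A B C a' b' c' Q" using ins inside_triangle_iff_weights[OF tri] by blast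
    have "bisector_offset B A C P = bisector_offset B A C Q" "bisector_offset C B A P = bisector_offset C B A Q"
      using eq unfolding f_def Let_def prod.inject by linarith+
    then have "angle P A B - angle P A C = angle Q A B - angle Q A C" "angle P B C - angle P B A = angle Q B C - angle Q B A"
      by (simp_all add: bisector_offset_def)
    then have "angle P A B = angle Q A B" "angle P B C = angle Q B C"
      using interior_angles(1,2)[OF P] interior_angles(1,2)[OF Q] by linarith+
    then show "P = Q" using interior_point_determined_by_two_angles[OF tri ins] by blast
  qed
  moreover have "finite (G \<times> G \<times> G)" by (simp add: G_def)
  ultimately show ?thesis using inj_on_finite by blast
qed

section \<open>Infinitely many similarity classes with only one subdivision\<close>

text \<open>The triangle with circumdiameter 1, whose sides are the sines of its angles.\<close>

lemma triangle_with_given_angles: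
  assumes "0 < \<alpha>" "0 < \<beta>" "\<alpha> + \<beta> < pi"
  shows "\<exists>A B C. triangle A B C \<and> angle B A C = \<alpha> \<and> angle A B C = \<beta> \<and> angle A C B = pi - \<alpha> - \<beta>"
proof -
  define A B C :: point where "A = 0" and "B = vector [sin (\<alpha> + \<beta>), 0]"
    and "C = vector [sin \<beta> * cos \<alpha>, sin \<beta> * sin \<alpha>]"
  have s: "sin \<alpha> > 0" "sin \<beta> > 0" "sin (\<alpha> + \<beta>) > 0" using assms by (auto intro!: sin_gt_zero)
  have CB: "(C - B) $ 1 = - sin \<alpha> * cos \<beta>" "(C - B) $ 2 = sin \<alpha> * sin \<beta>"
    by (simp_all add: B_def C_def vector_2 sin_add algebra_simps)
  have norms: "norm B = sin (\<alpha> + \<beta>)" "norm C = sin \<beta>" "norm (C - B) = sin \<alpha>"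
  proof -
    have "(norm B)\<^sup>2 = (sin (\<alpha> + \<beta>))\<^sup>2"
      unfolding power2_norm_eq_inner inner_point B_def vector_2 by algebra
    then show "norm B = sin (\<alpha> + \<beta>)" using s by (simp add: power2_eq_iff_nonneg)
    have "(norm C)\<^sup>2 = (sin \<beta>)\<^sup>2 * ((cos \<alpha>)\<^sup>2 + (sin \<alpha>)\<^sup>2)"
      unfolding power2_norm_eq_inner inner_point C_def vector_2 by algebra
    then show "norm C = sin \<beta>" using s by (simp add: power2_eq_iff_nonneg)
    have "(norm (C - B))\<^sup>2 = (sin \<alpha>)\<^sup>2 * ((cos \<beta>)\<^sup>2 + (sin \<beta>)\<^sup>2)"
      unfolding power2_norm_eq_inner inner_point CB by algebra
    then show "norm (C - B) = sin \<alpha>" using s by (simp add: power2_eq_iff_nonneg)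
  qed
  have ne: "B \<noteq> 0" "C \<noteq> 0" "C - B \<noteq> 0" using norms s by auto
  have "cross (B - A) (C - A) = sin (\<alpha> + \<beta>) * (sin \<beta> * sin \<alpha>)" by (simp add: A_def B_def C_def cross_def vector_2)
  then have tri: "triangle A B C" unfolding triangle_iff_cross using s by simp
  have a: "angle B A C = \<alpha>" unfolding angle_eq_vangle
  proof (rule vangle_eqI)
    show "(B - A) \<bullet> (C - A) = norm (B - A) * norm (C - A) * cos \<alpha>"
      unfolding A_def using norms by (simp add: inner_point) (simp add: B_def C_def vector_2)
  qed (use ne assms in \<open>auto simp: A_def\<close>)
  have b: "angle A B C = \<beta>" unfolding angle_eq_vangle
  proof (rule vangle_eqI)
    have "(- B) \<bullet> (C - B) = sin (\<alpha> + \<beta>) * sin \<alpha> * cos \<beta>"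
      unfolding inner_point CB by (simp add: B_def vector_2)
    then show "(A - B) \<bullet> (C - B) = norm (A - B) * norm (C - B) * cos \<beta>" unfolding A_def using norms by simp
  qed (use ne assms in \<open>auto simp: A_def\<close>)
  have "angle A C B = pi - \<alpha> - \<beta>" using angle_sum_triangle[OF tri] a b by simp
  then show ?thesis using tri a b by blast
qed

lemma special_triangle_only_incenter:
  assumes N: "N > 0" "30 dvd N" and tri: "triangle A B C"
    and a: "angle B A C = 2 * (pi / of_nat N)" and b: "angle A B C = 4 * (pi / of_nat N)"
    and c: "angle A C B = pi - 6 * (pi / of_nat N)"
  shows "pi_commensurable A B C" "pi_commensurable_subdivision A B C P \<Longrightarrow> is_incenter A B C P"
proof -
  have r: "rational_multiple_of_pi (of_nat k * (pi / of_nat N))" for k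
    unfolding rational_multiple_of_pi_def by (rule bexI[of _ "of_nat k / of_nat N"]) auto
  show pc: "pi_commensurable A B C"
    by (rule pi_commensurable_if_two_angles[OF tri]) (use a b r[of 2] r[of 4] in auto)
  assume P: "pi_commensurable_subdivision A B C P"
  define u v w where "u = bisector_offset B A C P" and "v = bisector_offset C B A P" and "w = bisector_offset A C B P"
  note off = subdivision_offsets[OF pc P, folded u_def v_def w_def, unfolded a b c]
  have lt: "\<bar>(u - v + w) + (u + v - w)\<bar> < 2 * (pi / of_nat N)" "\<bar>(- u + v + w) + (u + v - w)\<bar> < 4 * (pi / of_nat N)"
    "\<bar>(- u + v + w) + (u - v + w)\<bar> < pi - 6 * (pi / of_nat N)" using off(2-4) by simp_all
  have "- u + v + w = 0 \<and> u - v + w = 0 \<and> u + v - w = 0"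
    by (rule special_triangle_only_trivial_solution[OF N refl lt off(5-7,1)])
  then have "u = 0" "v = 0" "w = 0" by linarith+
  then show "is_incenter A B C P" using P
    by (simp add: is_incenter_def pi_commensurable_subdivision_def u_def v_def w_def bisector_offset_def)
qed

text \<open>A similarity invariant of the vertex set, independent of the order of the vertices; its minimum will separate the
classes.\<close>

definition angle_set :: "point set \<Rightarrow> real set" where
  "angle_set V = {angle X Y Z | X Y Z. X \<in> V \<and> Y \<in> V \<and> Z \<in> V \<and> X \<noteq> Y \<and> Y \<noteq> Z \<and> X \<noteq> Z}"

lemma angle_set_triangle:
  assumes "triangle A B C" shows "angle_set {A, B, C} = {angle B A C, angle A B C, angle A C B}"
proof -
  have "A \<noteq> B" "B \<noteq> C" "A \<noteq> C" using triangle_distinct[OF assms] by auto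
  then show ?thesis unfolding angle_set_def
    by (auto simp: angle_sym[of C A B] angle_sym[of C B A] angle_sym[of B C A])
qed

lemma similarity_preserves_angle:
  assumes "r > 0" "\<And>X Y. dist (f X) (f Y) = r * dist X Y"
  shows "angle (f X) (f Y) (f Z) = angle X Y Z"
proof -
  have n: "norm (f X - f Y) = r * norm (X - Y)" for X Y using assms(2)[of X Y] by (simp add: dist_norm)
  have inner: "2 * ((X - Y) \<bullet> (Z - Y)) = (norm (X - Y))\<^sup>2 + (norm (Z - Y))\<^sup>2 - (norm (X - Z))\<^sup>2" for X Y Z :: point
    by (simp add: power2_norm_eq_inner inner_diff inner_commute algebra_simps)
  have "2 * ((f X - f Y) \<bullet> (f Z - f Y)) = r\<^sup>2 * (2 * ((X - Y) \<bullet> (Z - Y)))"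
    unfolding inner n by (simp add: power_mult_distrib algebra_simps)
  then show ?thesis using assms(1) unfolding angle_def n by (simp add: power2_eq_square)
qed

lemma angle_set_similarity:
  assumes "r > 0" "\<And>X Y. dist (f X) (f Y) = r * dist X Y"
  shows "angle_set (f ` V) = angle_set V"
proof -
  have inj: "f X = f Y \<longleftrightarrow> X = Y" for X Y using assms(2)[of X Y] assms(1) by (metis dist_eq_0_iff mult_eq_0_iff less_irrefl)
  show ?thesis unfolding angle_set_def
  proof (intro Collect_cong iffI)
    fix t assume "\<exists>X Y Z. t = angle X Y Z \<and> X \<in> f ` V \<and> Y \<in> f ` V \<and> Z \<in> f ` V \<and> X \<noteq> Y \<and> Y \<noteq> Z \<and> X \<noteq> Z"
    then obtain X Y Z where "t = angle (f X) (f Y) (f Z)" "X \<in> V" "Y \<in> V" "Z \<in> V" "f X \<noteq> f Y" "f Y \<noteq> f Z" "f X \<noteq> f Z" by blast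
    then show "\<exists>X Y Z. t = angle X Y Z \<and> X \<in> V \<and> Y \<in> V \<and> Z \<in> V \<and> X \<noteq> Y \<and> Y \<noteq> Z \<and> X \<noteq> Z"
      using similarity_preserves_angle[OF assms, of X Y Z] by (intro exI[of _ X] exI[of _ Y] exI[of _ Z]) auto
  next
    fix t assume "\<exists>X Y Z. t = angle X Y Z \<and> X \<in> V \<and> Y \<in> V \<and> Z \<in> V \<and> X \<noteq> Y \<and> Y \<noteq> Z \<and> X \<noteq> Z"
    then obtain X Y Z where "t = angle X Y Z" "X \<in> V" "Y \<in> V" "Z \<in> V" "X \<noteq> Y" "Y \<noteq> Z" "X \<noteq> Z" by blast
    then show "\<exists>X Y Z. t = angle X Y Z \<and> X \<in> f ` V \<and> Y \<in> f ` V \<and> Z \<in> f ` V \<and> X \<noteq> Y \<and> Y \<noteq> Z \<and> X \<noteq> Z"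
      using similarity_preserves_angle[OF assms, of X Y Z] inj by (intro exI[of _ "f X"] exI[of _ "f Y"] exI[of _ "f Z"]) auto
  qed
qed

text \<open>The triangles with \<open>N = 30 (m + 1)\<close> for all \<open>m\<close> are told apart by their smallest angle \<open>2 pi / N\<close>.\<close>

theorem infinitely_many_classes_with_only_incenter:
  "infinite ({(A, B, C). pi_commensurable A B C
      \<and> (\<forall>P. pi_commensurable_subdivision A B C P \<longrightarrow> is_incenter A B C P)} // similar_triangles)" (is "infinite (?T // _)")
proof -
  define s where "s m = pi / of_nat (30 * Suc m)" for m
  have s: "0 < s m" "30 * s m \<le> pi" for m by (auto simp: s_def field_simps)
  have "\<exists>A B C. triangle A B C \<and> angle B A C = 2 * s m \<and> angle A B C = 4 * s m \<and> angle A C B = pi - 6 * s m" for m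
    using triangle_with_given_angles[of "2 * s m" "4 * s m"] s[of m] by (auto simp: algebra_simps)
  then obtain A B C where T: "\<And>m. triangle (A m) (B m) (C m)" "\<And>m. angle (B m) (A m) (C m) = 2 * s m"
    "\<And>m. angle (A m) (B m) (C m) = 4 * s m" "\<And>m. angle (A m) (C m) (B m) = pi - 6 * s m" by metis
  have set: "angle_set {A m, B m, C m} = {2 * s m, 4 * s m, pi - 6 * s m}" for m
    using angle_set_triangle[OF T(1)] T by simp
  have min: "Min (angle_set {A m, B m, C m}) = 2 * s m" for m
    unfolding set using s[of m] by (intro Min_eqI) auto
  have inT: "(A m, B m, C m) \<in> ?T" for m
    using special_triangle_only_incenter[of "30 * Suc m" "A m" "B m" "C m"] T[of m] by (auto simp: s_def)
  define cl where "cl m = similar_triangles `` {(A m, B m, C m)}" for m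
  have refl: "(A m, B m, C m) \<in> cl m" for m
    unfolding cl_def similar_triangles_def by (auto intro!: exI[of _ id] exI[of _ 1])
  have "inj cl"
  proof (rule injI)
    fix m n assume "cl m = cl n"
    then have "((A m, B m, C m), (A n, B n, C n)) \<in> similar_triangles" using refl[of n] unfolding cl_def by blast
    then obtain f r where "r > 0" "\<And>X Y. dist (f X) (f Y) = r * dist X Y" "f ` {A m, B m, C m} = {A n, B n, C n}"
      unfolding similar_triangles_def by blast
    then have "angle_set {A n, B n, C n} = angle_set {A m, B m, C m}" using angle_set_similarity by metis
    then have "s n = s m" using min by (metis mult_cancel_left zero_neq_numeral)
    then show "m = n" by (simp add: s_def)
  qed
  then have "infinite (range cl)" by (rule range_inj_infinite)
  moreover have "range cl \<subseteq> ?T // similar_triangles" unfolding cl_def using inT by (auto intro!: quotientI)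
  ultimately show ?thesis using finite_subset by blast
qed

theorem theorem2:
  shows "(\<forall>A B C. pi_commensurable A B C \<longrightarrow>
            (\<exists>!P. is_incenter A B C P)
          \<and> (\<forall>P. is_incenter A B C P \<longrightarrow> pi_commensurable_subdivision A B C P))
       \<and> infinite ({(A, B, C). pi_commensurable A B C
            \<and> (\<forall>P. pi_commensurable_subdivision A B C P \<longrightarrow> is_incenter A B C P)}
          // similar_triangles)
       \<and> (\<forall>A B C. pi_commensurable A B C \<and> \<not> isosceles A B C \<longrightarrow>
            finite {P. pi_commensurable_subdivision A B C P})"
proof (intro conjI allI impI)
  show "\<exists>!P. is_incenter A B C P" if "pi_commensurable A B C" for A B C
    using that incenter_exists_unique by (simp add: pi_commensurable_def)
  show "pi_commensurable_subdivision A B C P" if "pi_commensurable A B C" "is_incenter A B C P" for A B C P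
    using incenter_commensurable[OF that] .
  show "finite {P. pi_commensurable_subdivision A B C P}" if "pi_commensurable A B C \<and> \<not> isosceles A B C" for A B C
    using that finitely_many_subdivisions by blast
qed (rule infinitely_many_classes_with_only_incenter)

end
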